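(* Suppose that a solution $(E,F,G)$ to the system $$\begin{array}{l} 2EF_u-FE_u-EE_v=0,\\ 2GF_v-FG_v-GG_u=0,\\ GE_u+EG_v-2F(F_u+F_v)+(3F-2G)E_v+(3F-2E)G_u=0\end{array}$$ is invariant with respect to the one-dimensional algebra generated by $\partial_u+\kappa\,\partial_v+E\partial_E+F\partial_F+G\partial_G$ (with any constant $\kappa$) or by $u\partial_u+v\partial_v+\kappa\,(E\partial_E+F\partial_F+G\partial_G)$ with a constant $\kappa\neq-2$. Then the surface with the corresponding metric $E\,du^2+2F\,du\,dv+G\,dv^2$ can be realized locally as a Lie spiral surface.
   Context: Solutions are local and satisfy $E>0$, $EG-F^2>0$. A solution is invariant with respect to a vector field $X$ on $\mathbb R^5$ (with coordinates $u,v,E,F,G$) if the local flow of $X$ preserves the surface $\{(u,v,E(u,v),F(u,v),G(u,v))\}\subset\mathbb R^5$, i.e. $X$ is tangent to it. A Lie spiral surface in Euclidean $\mathbb R^3$ is a surface obtained from a generating curve by a one-parameter group of rotations about a fixed axis combined with homotheties whose center lies on the axis, the rate being exponential in the rotation angle; with the $z$-axis as axis and the origin as center it can be parametrized by $(\theta,r)$ as $x=e^\theta r\cos(\alpha\theta)$, $y=e^\theta r\sin(\alpha\theta)$, $z=e^\theta W(r)$, where $\alpha$ is a constant and $W$ is a function. "Realized locally" means locally isometrically immersed in $\mathbb R^3$ with image such a surface. *)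

theory Defs
  imports "HOL-Analysis.Analysis"
begin

section \<open>Smooth maps and partial derivatives\<close>

text \<open>Meant for open sets \<open>S\<close> in finite-dimensional spaces, where the directional form of the
  recursion is the usual notion of a map of class \<open>C\<^sup>k\<close>.\<close>

primrec Ck_on :: "nat \<Rightarrow> 'a::real_normed_vector set \<Rightarrow> ('a \<Rightarrow> 'b::real_normed_vector) \<Rightarrow> bool"
where
  "Ck_on 0 S f \<longleftrightarrow> continuous_on S f"
| "Ck_on (Suc k) S f \<longleftrightarrow>
     (\<forall>x\<in>S. f differentiable (at x)) \<and>
     (\<forall>v. Ck_on k S (\<lambda>x. frechet_derivative f (at x) v))"

definition smooth_on :: "'a::real_normed_vector set \<Rightarrow> ('a \<Rightarrow> 'b::real_normed_vector) \<Rightarrow> bool"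
where "smooth_on S f \<longleftrightarrow> (\<forall>k. Ck_on k S f)"

definition partial_u :: "(real \<times> real \<Rightarrow> 'b::real_normed_vector) \<Rightarrow> real \<times> real \<Rightarrow> 'b"
where "partial_u f p = frechet_derivative f (at p) (1, 0)"

definition partial_v :: "(real \<times> real \<Rightarrow> 'b::real_normed_vector) \<Rightarrow> real \<times> real \<Rightarrow> 'b"
where "partial_v f p = frechet_derivative f (at p) (0, 1)"

section \<open>Solutions of the system\<close>

definition is_solution ::
  "(real \<times> real) set \<Rightarrow> (real \<times> real \<Rightarrow> real) \<Rightarrow> (real \<times> real \<Rightarrow> real) \<Rightarrow> (real \<times> real \<Rightarrow> real) \<Rightarrow> bool"
where
  "is_solution U E F G \<longleftrightarrow>
     smooth_on U E \<and> smooth_on U F \<and> smooth_on U G \<and>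
     (\<forall>p\<in>U. E p > 0 \<and> E p * G p - (F p)\<^sup>2 > 0 \<and>
        2 * E p * partial_u F p - F p * partial_u E p - E p * partial_v E p = 0 \<and>
        2 * G p * partial_v F p - F p * partial_v G p - G p * partial_u G p = 0 \<and>
        G p * partial_u E p + E p * partial_v G p
          - 2 * F p * (partial_u F p + partial_v F p)
          + (3 * F p - 2 * G p) * partial_v E p
          + (3 * F p - 2 * E p) * partial_u G p = 0)"

section \<open>Invariance under a vector field on the five-dimensional space\<close>

type_synonym real5 = "real \<times> real \<times> real \<times> real \<times> real"

definition solution_graph ::
  "(real \<times> real \<Rightarrow> real) \<Rightarrow> (real \<times> real \<Rightarrow> real) \<Rightarrow> (real \<times> real \<Rightarrow> real) \<Rightarrow> real \<times> real \<Rightarrow> real5"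
where "solution_graph E F G p = (fst p, snd p, E p, F p, G p)"

text \<open>The range of the derivative of the graph map is the tangent plane of the surface.\<close>

definition invariant_solution ::
  "(real \<times> real) set \<Rightarrow> (real \<times> real \<Rightarrow> real) \<Rightarrow> (real \<times> real \<Rightarrow> real) \<Rightarrow> (real \<times> real \<Rightarrow> real) \<Rightarrow>
   (real5 \<Rightarrow> real5) \<Rightarrow> bool"
where
  "invariant_solution U E F G X \<longleftrightarrow>
     (\<forall>p\<in>U. X (solution_graph E F G p)
        \<in> range (frechet_derivative (solution_graph E F G) (at p)))"

definition translation_field :: "real \<Rightarrow> real5 \<Rightarrow> real5"
where "translation_field \<kappa> = (\<lambda>(u, v, E, F, G). (1, \<kappa>, E, F, G))"

definition dilation_field :: "real \<Rightarrow> real5 \<Rightarrow> real5"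
where "dilation_field \<kappa> = (\<lambda>(u, v, E, F, G). (u, v, \<kappa> * E, \<kappa> * F, \<kappa> * G))"

section \<open>Isometric immersions and Lie spiral surfaces\<close>

definition isometric_immersion_on ::
  "(real \<times> real) set \<Rightarrow> (real \<times> real \<Rightarrow> real) \<Rightarrow> (real \<times> real \<Rightarrow> real) \<Rightarrow> (real \<times> real \<Rightarrow> real) \<Rightarrow>
   (real \<times> real \<Rightarrow> real^3) \<Rightarrow> bool"
where
  "isometric_immersion_on V E F G f \<longleftrightarrow>
     smooth_on V f \<and>
     (\<forall>p\<in>V. partial_u f p \<bullet> partial_u f p = E p \<and>
             partial_u f p \<bullet> partial_v f p = F p \<and>
             partial_v f p \<bullet> partial_v f p = G p)"

definition immersion_on :: "(real \<times> real) set \<Rightarrow> (real \<times> real \<Rightarrow> real^3) \<Rightarrow> bool"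
where
  "immersion_on S \<sigma> \<longleftrightarrow>
     smooth_on S \<sigma> \<and> (\<forall>p\<in>S. inj (frechet_derivative \<sigma> (at p)))"

text \<open>The generating curve \<open>s \<mapsto> (\<rho> s, 0, w s)\<close> is rotated by the angle \<open>\<alpha> * \<theta>\<close> about the
  \<open>z\<close>-axis and scaled by \<open>exp \<theta>\<close>. Where the derivative of \<open>\<rho>\<close> does not vanish, \<open>r = \<rho> s\<close>
  can be used as parameter instead of \<open>s\<close>, which gives the form with third component
  \<open>exp \<theta> * W r\<close>; a general curve may also have points with tangent parallel to the axis.\<close>

definition spiral_map :: "real \<Rightarrow> (real \<Rightarrow> real) \<Rightarrow> (real \<Rightarrow> real) \<Rightarrow> real \<times> real \<Rightarrow> real^3"
where
  "spiral_map \<alpha> \<rho> w = (\<lambda>(\<theta>, s).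
     vector [exp \<theta> * \<rho> s * cos (\<alpha> * \<theta>), exp \<theta> * \<rho> s * sin (\<alpha> * \<theta>), exp \<theta> * w s])"

text \<open>The isometry \<open>x \<mapsto> c + L x\<close> carries the \<open>z\<close>-axis and the origin to an arbitrary axis and
  a centre on it. For \<open>\<alpha> = 0\<close> there would be no rotation.\<close>

definition lie_spiral_surface :: "(real^3) set \<Rightarrow> bool"
where
  "lie_spiral_surface S \<longleftrightarrow>
     (\<exists>c L \<alpha> \<rho> w \<Theta> J.
        orthogonal_transformation L \<and> \<alpha> \<noteq> 0 \<and>
        open \<Theta> \<and> connected \<Theta> \<and> \<Theta> \<noteq> {} \<and> open J \<and> connected J \<and> J \<noteq> {} \<and>
        smooth_on J \<rho> \<and> smooth_on J w \<and>
        immersion_on (\<Theta> \<times> J) (spiral_map \<alpha> \<rho> w) \<and>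
        S = (\<lambda>x. c + L x) ` spiral_map \<alpha> \<rho> w ` (\<Theta> \<times> J))"

definition locally_realizable_as_lie_spiral ::
  "(real \<times> real) set \<Rightarrow> (real \<times> real \<Rightarrow> real) \<Rightarrow> (real \<times> real \<Rightarrow> real) \<Rightarrow> (real \<times> real \<Rightarrow> real) \<Rightarrow> bool"
where
  "locally_realizable_as_lie_spiral U E F G \<longleftrightarrow>
     (\<forall>p\<in>U. \<exists>V f. open V \<and> p \<in> V \<and> V \<subseteq> U \<and>
        isometric_immersion_on V E F G f \<and> lie_spiral_surface (f ` V))"

end

theory Submission
  imports Defs
begin

text \<open>The differential equations of the system play no role: invariance makes the given vector field
  homothetic for the metric, with a nonzero rate exactly because \<open>\<kappa> \<noteq> -2\<close> in the dilation case. Away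
  from its zeros one straightens the field and gets
  \<open>g = exp (2 k \<tau>) (a d\<tau>\<^sup>2 + 2 b d\<tau> ds + c ds\<^sup>2)\<close> with \<open>a\<close>, \<open>b\<close>, \<open>c\<close> depending on \<open>s\<close> only. Put
  \<open>\<beta> = (b k - a'/2) / a\<close> and \<open>D = (a c - b\<^sup>2) k\<^sup>2 / a\<^sup>2\<close>. Requiring that the spiral surface with profile
  \<open>\<rho> = exp (-K) / sqrt (1 + \<alpha>\<^sup>2)\<close>, \<open>w = exp (-K) z\<close> and angle parameter \<open>\<theta> = k \<tau> + h s\<close> has this metric
  amounts to
  \<open>z' = (1 + z\<^sup>2) (\<beta> z - sqrt (D - (\<beta>\<^sup>2 / \<alpha>\<^sup>2) (1 + z\<^sup>2)))\<close>,
  with \<open>K\<close> and \<open>h\<close> then given by quadratures. For large \<open>\<alpha>\<close> the radicand is positive near \<open>z = 0\<close>, so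
  the equation is locally solvable by Picard iteration. At the zero of the dilation field the metric
  coefficients are locally constant, and a dilation about another centre can be used instead.\<close>

section \<open>Calculus of smooth maps\<close>

lemma Ck_on_Suc_imp:
  assumes "Ck_on (Suc k) S f"
  shows "Ck_on k S f"
  using assms
proof (induction k arbitrary: f)
  case 0
  then show ?case
    by (auto intro!: continuous_at_imp_continuous_on differentiable_imp_continuous_within)
next
  case (Suc k)
  then show ?case by auto
qed

lemma Ck_on_imp_continuous_on: "Ck_on k S f \<Longrightarrow> continuous_on S f"
  by (induction k) (auto dest: Ck_on_Suc_imp
      intro!: continuous_at_imp_continuous_on differentiable_imp_continuous_within)

lemma Ck_on_subset: "Ck_on k S f \<Longrightarrow> T \<subseteq> S \<Longrightarrow> Ck_on k T f"
  by (induction k arbitrary: f) (auto intro: continuous_on_subset)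

text \<open>\<open>frechet_derivative\<close> at a point depends only on values near that point, so
  on an open set equality of the maps passes to every level of the recursion.\<close>

lemma Ck_on_cong:
  assumes "open S" "\<And>x. x \<in> S \<Longrightarrow> f x = g x" "Ck_on k S f"
  shows "Ck_on k S g"
  using assms(2,3)
proof (induction k arbitrary: f g)
  case 0
  then show ?case using continuous_on_cong by fastforce
next
  case (Suc k)
  have d: "f differentiable at x" if "x \<in> S" for x using Suc.prems that by auto
  have fd: "frechet_derivative f (at x) = frechet_derivative g (at x)" if "x \<in> S" for x
    using frechet_derivative_transform_within_open[OF d[OF that] assms(1) that] Suc.prems(1) by blast
  have "g differentiable at x" if "x \<in> S" for x
  proof -
    have "(f has_derivative frechet_derivative f (at x)) (at x)"
      using d[OF that] frechet_derivative_works by blast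
    then have "(g has_derivative frechet_derivative f (at x)) (at x)"
      by (rule has_derivative_transform_within_open[OF _ assms(1) that]) (use Suc.prems(1) in auto)
    then show ?thesis by (auto simp: differentiable_def)
  qed
  moreover have "Ck_on k S (\<lambda>x. frechet_derivative g (at x) v)" for v
    by (rule Suc.IH[of "\<lambda>x. frechet_derivative f (at x) v"]) (use fd Suc.prems in auto)
  ultimately show ?case by auto
qed

text \<open>Trades the chosen \<open>frechet_derivative\<close> for an explicit derivative
  \<open>f'\<close>, so that inductions on \<open>k\<close> can work with closed formulas.\<close>

lemma Ck_on_SucI:
  assumes "open S" "\<And>x. x \<in> S \<Longrightarrow> (f has_derivative f' x) (at x)"
    and "\<And>v. Ck_on k S (\<lambda>x. f' x v)"
  shows "Ck_on (Suc k) S f"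
proof -
  have "frechet_derivative f (at x) = f' x" if "x \<in> S" for x
    using frechet_derivative_at[OF assms(2)[OF that]] by simp
  then have "Ck_on k S (\<lambda>x. frechet_derivative f (at x) v)" for v
    by (intro Ck_on_cong[OF assms(1) _ assms(3)[of v]]) auto
  moreover have "f differentiable at x" if "x \<in> S" for x
    using assms(2)[OF that] differentiable_def by blast
  ultimately show ?thesis by auto
qed

lemma Ck_on_SucD:
  assumes "Ck_on (Suc k) S f" "x \<in> S"
  shows "(f has_derivative frechet_derivative f (at x)) (at x)"
  using assms frechet_derivative_works by auto

lemma Ck_on_const: "open S \<Longrightarrow> Ck_on k S (\<lambda>x. c)"
proof (induction k arbitrary: c)
  case (Suc k)
  show ?case by (rule Ck_on_SucI[where f'="\<lambda>x v. 0"]) (use Suc in auto)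
qed auto

lemma Ck_on_linear_compose:
  assumes "bounded_linear L" "open S" "Ck_on k S f"
  shows "Ck_on k S (\<lambda>x. L (f x))"
  using assms(3)
proof (induction k arbitrary: f)
  case 0
  then show ?case using bounded_linear.continuous_on[OF assms(1)] by auto
next
  case (Suc k)
  show ?case
    by (rule Ck_on_SucI[where f'="\<lambda>x v. L (frechet_derivative f (at x) v)"])
      (use Suc assms(2) Ck_on_SucD[OF Suc.prems] in \<open>auto intro: bounded_linear.has_derivative[OF assms(1)]\<close>)
qed

lemma Ck_on_id: "open S \<Longrightarrow> Ck_on k S (\<lambda>x. x)"
  by (cases k) (auto intro!: Ck_on_SucI[where f'="\<lambda>x v. v"] Ck_on_const)

lemma Ck_on_add:
  assumes "open S" "Ck_on k S f" "Ck_on k S g"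
  shows "Ck_on k S (\<lambda>x. f x + g x)"
  using assms(2,3)
proof (induction k arbitrary: f g)
  case 0
  then show ?case by (auto intro: continuous_on_add)
next
  case (Suc k)
  show ?case
    by (rule Ck_on_SucI[where f'="\<lambda>x v. frechet_derivative f (at x) v + frechet_derivative g (at x) v"])
      (use Suc assms(1) Ck_on_SucD[OF Suc.prems(1)] Ck_on_SucD[OF Suc.prems(2)]
        in \<open>auto intro: has_derivative_add\<close>)
qed

lemma Ck_on_sum:
  assumes "open S" "\<And>i. i \<in> I \<Longrightarrow> Ck_on k S (f i)"
  shows "Ck_on k S (\<lambda>x. \<Sum>i\<in>I. f i x)"
  using assms(2)
  by (induction I rule: infinite_finite_induct) (auto intro: Ck_on_const Ck_on_add assms(1))

lemma Ck_on_bilinear: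
  assumes "bounded_bilinear B" "open S" "Ck_on k S f" "Ck_on k S g"
  shows "Ck_on k S (\<lambda>x. B (f x) (g x))"
  using assms(3,4)
proof (induction k arbitrary: f g)
  case 0
  then show ?case using bounded_bilinear.continuous_on[OF assms(1)] by auto
next
  case (Suc k)
  have "Ck_on k S (\<lambda>x. B (f x) (frechet_derivative g (at x) v) + B (frechet_derivative f (at x) v) (g x))"
    for v
    by (intro Ck_on_add assms Suc.IH) (use Suc.prems Ck_on_Suc_imp in auto)
  then show ?case
    by (intro Ck_on_SucI[where f'="\<lambda>x v. B (f x) (frechet_derivative g (at x) v)
          + B (frechet_derivative f (at x) v) (g x)"])
      (use assms(2) Ck_on_SucD[OF Suc.prems(1)] Ck_on_SucD[OF Suc.prems(2)]
        in \<open>auto intro: bounded_bilinear.FDERIV[OF assms(1)]\<close>)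
qed

text \<open>The chain rule evaluates the derivative of \<open>g\<close> in the direction
  \<open>f' x v\<close>, which moves with \<open>x\<close>, while \<open>Ck_on\<close> controls
  fixed directions only. Expanding this direction in \<open>Basis\<close> leaves a finite sum of
  products to which the induction hypothesis applies; this is where the Euclidean intermediate space
  enters.\<close>

lemma Ck_on_compose:
  fixes f :: "'a::real_normed_vector \<Rightarrow> 'b::euclidean_space"
  assumes "open S" "f ` S \<subseteq> T" "Ck_on k T g" "Ck_on k S f"
  shows "Ck_on k S (\<lambda>x. g (f x))"
  using assms(3,4)
proof (induction k arbitrary: g)
  case 0
  then show ?case using continuous_on_compose2[OF _ _ assms(2)] by auto
next
  case (Suc k)
  let ?f' = "\<lambda>x. frechet_derivative f (at x)" and ?g' = "\<lambda>x. frechet_derivative g (at x)"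
  have lin: "linear (?g' (f x))" if "x \<in> S" for x
    using Ck_on_SucD[OF Suc.prems(1), of "f x"] assms(2) that
    by (auto dest: has_derivative_linear)
  have ck: "Ck_on k S (\<lambda>x. \<Sum>i\<in>Basis. (?f' x v \<bullet> i) *\<^sub>R ?g' (f x) i)" for v
    using Suc.prems
    by (intro Ck_on_sum Ck_on_bilinear[OF bounded_bilinear_scaleR] assms(1) Suc.IH
        Ck_on_linear_compose[OF bounded_linear_inner_left])
      (auto intro: Ck_on_Suc_imp)
  show ?case
  proof (rule Ck_on_SucI[where f'="\<lambda>x v. ?g' (f x) (?f' x v)"])
    show "((\<lambda>x. g (f x)) has_derivative (\<lambda>v. ?g' (f x) (?f' x v))) (at x)" if "x \<in> S" for x
      using has_derivative_compose[OF Ck_on_SucD[OF Suc.prems(2) that]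
          Ck_on_SucD[OF Suc.prems(1), of "f x"]] assms(2) that by auto
    have "?g' (f x) (?f' x v) = (\<Sum>i\<in>Basis. (?f' x v \<bullet> i) *\<^sub>R ?g' (f x) i)" if "x \<in> S" for x v
    proof -
      have "?g' (f x) (?f' x v) = ?g' (f x) (\<Sum>i\<in>Basis. (?f' x v \<bullet> i) *\<^sub>R i)"
        by (simp add: euclidean_representation)
      then show ?thesis using lin[OF that] by (simp add: linear_sum linear_scale)
    qed
    then show "Ck_on k S (\<lambda>x. ?g' (f x) (?f' x v))" for v
      by (intro Ck_on_cong[OF assms(1) _ ck[of v]]) auto
  qed (rule assms)
qed

lemma Ck_on_real_SucI:
  fixes f :: "real \<Rightarrow> real"
  assumes "open S" "\<And>x. x \<in> S \<Longrightarrow> (f has_real_derivative f' x) (at x)" "Ck_on k S f'"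
  shows "Ck_on (Suc k) S f"
  by (rule Ck_on_SucI[where f'="\<lambda>x v. f' x * v"])
    (use assms in \<open>auto simp: has_field_derivative_def intro: Ck_on_linear_compose[OF bounded_linear_mult_left]\<close>)

section \<open>Closure properties of smooth maps\<close>

lemma smooth_onI: "(\<And>k. Ck_on k S f) \<Longrightarrow> smooth_on S f"
  by (simp add: smooth_on_def)

lemma smooth_onD: "smooth_on S f \<Longrightarrow> Ck_on k S f"
  by (simp add: smooth_on_def)

lemma smooth_on_imp_continuous_on: "smooth_on S f \<Longrightarrow> continuous_on S f"
  by (rule Ck_on_imp_continuous_on[OF smooth_onD])

lemma smooth_on_has_derivative:
  "smooth_on S f \<Longrightarrow> x \<in> S \<Longrightarrow> (f has_derivative frechet_derivative f (at x)) (at x)"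
  by (rule Ck_on_SucD[OF smooth_onD])

lemma smooth_on_real_derivative:
  fixes f :: "real \<Rightarrow> real"
  assumes "open S" "\<And>x. x \<in> S \<Longrightarrow> (f has_real_derivative f' x) (at x)" "smooth_on S f"
  shows "smooth_on S f'"
proof (rule smooth_onI)
  fix k
  have "frechet_derivative f (at x) 1 = f' x" if "x \<in> S" for x
    by (subst frechet_derivative_at[OF assms(2)[OF that, unfolded has_field_derivative_def], symmetric])
      simp
  moreover have "Ck_on k S (\<lambda>x. frechet_derivative f (at x) 1)"
    using smooth_onD[OF assms(3), of "Suc k"] by simp
  ultimately show "Ck_on k S f'" by (rule Ck_on_cong[OF assms(1)])
qed

lemma smooth_on_subset: "smooth_on S f \<Longrightarrow> T \<subseteq> S \<Longrightarrow> smooth_on T f"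
  by (auto simp: smooth_on_def intro: Ck_on_subset)

lemma smooth_on_const [simp]: "open S \<Longrightarrow> smooth_on S (\<lambda>x. c)"
  by (simp add: smooth_on_def Ck_on_const)

lemma smooth_on_id [simp]: "open S \<Longrightarrow> smooth_on S (\<lambda>x. x)"
  by (simp add: smooth_on_def Ck_on_id)

lemma smooth_on_linear_compose:
  "bounded_linear L \<Longrightarrow> open S \<Longrightarrow> smooth_on S f \<Longrightarrow> smooth_on S (\<lambda>x. L (f x))"
  by (simp add: smooth_on_def Ck_on_linear_compose)

lemma smooth_on_fst: "open S \<Longrightarrow> smooth_on S f \<Longrightarrow> smooth_on S (\<lambda>x. fst (f x))"
  by (rule smooth_on_linear_compose[OF bounded_linear_fst])

lemma smooth_on_snd: "open S \<Longrightarrow> smooth_on S f \<Longrightarrow> smooth_on S (\<lambda>x. snd (f x))"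
  by (rule smooth_on_linear_compose[OF bounded_linear_snd])

lemma smooth_on_add:
  "open S \<Longrightarrow> smooth_on S f \<Longrightarrow> smooth_on S g \<Longrightarrow> smooth_on S (\<lambda>x. f x + g x)"
  by (simp add: smooth_on_def Ck_on_add)

lemma smooth_on_minus: "open S \<Longrightarrow> smooth_on S f \<Longrightarrow> smooth_on S (\<lambda>x. - f x)"
  by (rule smooth_on_linear_compose[OF bounded_linear_minus[OF bounded_linear_ident]])

lemma smooth_on_diff:
  "open S \<Longrightarrow> smooth_on S f \<Longrightarrow> smooth_on S g \<Longrightarrow> smooth_on S (\<lambda>x. f x - g x)"
  using smooth_on_add[OF _ _ smooth_on_minus, of S f g] by simp

lemma smooth_on_mult:
  fixes f g :: "'a::real_normed_vector \<Rightarrow> real"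
  shows "open S \<Longrightarrow> smooth_on S f \<Longrightarrow> smooth_on S g \<Longrightarrow> smooth_on S (\<lambda>x. f x * g x)"
  by (simp add: smooth_on_def Ck_on_bilinear[OF bounded_bilinear_mult])

lemma smooth_on_scaleR:
  "open S \<Longrightarrow> smooth_on S f \<Longrightarrow> smooth_on S g \<Longrightarrow> smooth_on S (\<lambda>x. f x *\<^sub>R g x)"
  by (simp add: smooth_on_def Ck_on_bilinear[OF bounded_bilinear_scaleR])

lemma smooth_on_power:
  fixes f :: "'a::real_normed_vector \<Rightarrow> real"
  shows "open S \<Longrightarrow> smooth_on S f \<Longrightarrow> smooth_on S (\<lambda>x. f x ^ n)"
  by (induction n) (auto intro: smooth_on_mult)

lemma smooth_on_Pair:
  assumes "open S" "smooth_on S f" "smooth_on S g"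
  shows "smooth_on S (\<lambda>x. (f x, g x))"
proof -
  have "smooth_on S (\<lambda>x. (f x, 0) + (0, g x))"
    using assms
    by (intro smooth_on_add smooth_on_linear_compose[of "\<lambda>y. (y, 0)"] smooth_on_linear_compose[of "\<lambda>y. (0, y)"])
      (auto intro!: bounded_linear_Pair bounded_linear_ident bounded_linear_zero)
  then show ?thesis by simp
qed

lemma smooth_on_compose:
  fixes f :: "'a::real_normed_vector \<Rightarrow> 'b::euclidean_space"
  assumes "smooth_on T g" "open S" "smooth_on S f" "\<And>x. x \<in> S \<Longrightarrow> f x \<in> T"
  shows "smooth_on S (\<lambda>x. g (f x))"
  by (intro smooth_onI, rule Ck_on_compose[where T=T]) (use assms in \<open>auto dest: smooth_onD\<close>)

section \<open>Elementary functions\<close>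

lemma smooth_on_exp_real: "smooth_on UNIV (exp :: real \<Rightarrow> real)"
proof (rule smooth_onI)
  show "Ck_on k UNIV (exp :: real \<Rightarrow> real)" for k
    by (induction k)
      (simp_all del: Ck_on.simps(2) add: Ck_on_real_SucI[where f'=exp] continuous_on_exp)
qed

text \<open>Differentiation exchanges the two functions up to sign, so both are carried through one
  induction.\<close>

lemma smooth_on_sin_cos_real:
  "smooth_on UNIV (sin :: real \<Rightarrow> real)" "smooth_on UNIV (cos :: real \<Rightarrow> real)"
proof -
  have "Ck_on k UNIV (sin :: real \<Rightarrow> real) \<and> Ck_on k UNIV (cos :: real \<Rightarrow> real)" for k
  proof (induction k)
    case 0
    show ?case by (simp add: continuous_on_sin continuous_on_cos)
  next
    case (Suc k)
    have "Ck_on (Suc k) UNIV (sin :: real \<Rightarrow> real)"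
      by (rule Ck_on_real_SucI[where f'=cos]) (use Suc in auto)
    moreover have "Ck_on (Suc k) UNIV (cos :: real \<Rightarrow> real)"
      by (rule Ck_on_real_SucI[where f'="\<lambda>x. - sin x"])
        (use Suc in \<open>auto intro!: derivative_eq_intros
          Ck_on_linear_compose[OF bounded_linear_minus[OF bounded_linear_ident]]\<close>)
    ultimately show ?case by blast
  qed
  then show "smooth_on UNIV (sin :: real \<Rightarrow> real)" "smooth_on UNIV (cos :: real \<Rightarrow> real)"
    by (simp_all add: smooth_on_def)
qed

text \<open>The derivative is minus the square of the function itself, so the induction closes.
  Positive reals are enough as a domain: the quotients formed later have positive
  denominators.\<close>

lemma smooth_on_inverse_real: "smooth_on {0<..} (inverse :: real \<Rightarrow> real)"
proof (rule smooth_onI)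
  show "Ck_on k {0<..} (inverse :: real \<Rightarrow> real)" for k
  proof (induction k)
    case 0
    show ?case by (simp add: continuous_on_inverse)
  next
    case (Suc k)
    have "Ck_on k {0<..} (\<lambda>x::real. - (inverse x * inverse x))"
      by (intro Ck_on_linear_compose[OF bounded_linear_minus[OF bounded_linear_ident]]
          Ck_on_bilinear[OF bounded_bilinear_mult] Suc) auto
    then show ?case
      by (intro Ck_on_real_SucI) (auto intro!: derivative_eq_intros)
  qed
qed

lemma smooth_on_ln_real: "smooth_on {0<..} (ln :: real \<Rightarrow> real)"
proof (rule smooth_onI)
  show "Ck_on k {0<..} (ln :: real \<Rightarrow> real)" for k
  proof (cases k)
    case (Suc n)
    show ?thesis unfolding Suc
      by (rule Ck_on_real_SucI[OF _ _ smooth_onD[OF smooth_on_inverse_real]])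
        (auto intro!: derivative_eq_intros simp: field_simps)
  qed (simp add: continuous_on_ln)
qed

lemma smooth_on_exp:
  fixes f :: "'a::real_normed_vector \<Rightarrow> real"
  shows "open S \<Longrightarrow> smooth_on S f \<Longrightarrow> smooth_on S (\<lambda>x. exp (f x))"
  by (rule smooth_on_compose[OF smooth_on_exp_real]) auto

lemma smooth_on_sin:
  fixes f :: "'a::real_normed_vector \<Rightarrow> real"
  shows "open S \<Longrightarrow> smooth_on S f \<Longrightarrow> smooth_on S (\<lambda>x. sin (f x))"
  by (rule smooth_on_compose[OF smooth_on_sin_cos_real(1)]) auto

lemma smooth_on_cos:
  fixes f :: "'a::real_normed_vector \<Rightarrow> real"
  shows "open S \<Longrightarrow> smooth_on S f \<Longrightarrow> smooth_on S (\<lambda>x. cos (f x))"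
  by (rule smooth_on_compose[OF smooth_on_sin_cos_real(2)]) auto

lemma smooth_on_ln:
  fixes f :: "'a::real_normed_vector \<Rightarrow> real"
  shows "open S \<Longrightarrow> smooth_on S f \<Longrightarrow> (\<And>x. x \<in> S \<Longrightarrow> f x > 0) \<Longrightarrow> smooth_on S (\<lambda>x. ln (f x))"
  by (rule smooth_on_compose[OF smooth_on_ln_real]) auto

lemma smooth_on_divide:
  fixes f g :: "'a::real_normed_vector \<Rightarrow> real"
  assumes "open S" "smooth_on S f" "smooth_on S g" "\<And>x. x \<in> S \<Longrightarrow> g x > 0"
  shows "smooth_on S (\<lambda>x. f x / g x)"
  unfolding divide_inverse
  using assms by (intro smooth_on_mult smooth_on_compose[OF smooth_on_inverse_real, of S g]) auto

lemma smooth_on_sqrt: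
  fixes f :: "'a::real_normed_vector \<Rightarrow> real"
  assumes "open S" "smooth_on S f" "\<And>x. x \<in> S \<Longrightarrow> f x > 0"
  shows "smooth_on S (\<lambda>x. sqrt (f x))"
proof (rule smooth_onI)
  fix k
  have "smooth_on S (\<lambda>x. exp (1 / 2 * ln (f x)))"
    using assms by (intro smooth_on_exp smooth_on_mult smooth_on_ln smooth_on_const)
  moreover have "exp (1 / 2 * ln (f x)) = sqrt (f x)" if "x \<in> S" for x
    using powr_half_sqrt[of "f x"] assms(3)[OF that] by (simp add: powr_def)
  ultimately show "Ck_on k S (\<lambda>x. sqrt (f x))"
    using Ck_on_cong[OF assms(1), of "\<lambda>x. exp (1 / 2 * ln (f x))" "\<lambda>x. sqrt (f x)" k]
    by (simp add: smooth_onD)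
qed

lemmas smooth_on_intros =
  smooth_on_const smooth_on_id smooth_on_fst smooth_on_snd smooth_on_add smooth_on_minus
  smooth_on_diff smooth_on_mult smooth_on_scaleR smooth_on_power smooth_on_Pair smooth_on_exp
  smooth_on_sin smooth_on_cos smooth_on_ln smooth_on_divide smooth_on_sqrt

section \<open>Scalar ordinary differential equations\<close>

lemma open_contains_square:
  fixes D :: "(real \<times> real) set"
  assumes "open D" "(0, 0) \<in> D"
  obtains r where "r > 0" "{-r..r} \<times> {-r..r} \<subseteq> D"
proof -
  obtain e where e: "e > 0" "ball (0, 0) e \<subseteq> D"
    using assms by (auto simp: open_contains_ball)
  have "{-(e/3)..e/3} \<times> {-(e/3)..e/3} \<subseteq> D"
  proof
    fix x assume "x \<in> {-(e/3)..e/3} \<times> {-(e/3)..e/3}"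
    then obtain a b where x: "x = (a, b)" "\<bar>a\<bar> \<le> e/3" "\<bar>b\<bar> \<le> e/3" by auto
    have "norm x \<le> norm a + norm b" using x norm_Pair_le[of a b] by simp
    also have "\<dots> < e" using x e by simp
    finally have "x \<in> ball (0, 0) e" by (simp add: dist_norm norm_minus_commute zero_prod_def[symmetric])
    then show "x \<in> D" using e by auto
  qed
  then show ?thesis using e that[of "e/3"] by simp
qed

text \<open>Picard iteration as a contraction on bounded continuous functions on the whole line.
  Clamping both time and value makes the operator total on that space, and the clamps turn out to be
  inactive at the fixed point. The integral starts at the left end of the interval, so the solution
  built here vanishes at \<open>-\<delta>\<close>; no value at 0 is prescribed.\<close>

lemma scalar_ode_local_solution:
  fixes H :: "real \<times> real \<Rightarrow> real"
  assumes "open D" "(0, 0) \<in> D" "Ck_on 1 D H"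
  obtains \<delta> z where "\<delta> > 0" "\<And>s. s \<in> {-\<delta><..<\<delta>} \<Longrightarrow> (s, z s) \<in> D"
    "\<And>s. s \<in> {-\<delta><..<\<delta>} \<Longrightarrow> (z has_real_derivative H (s, z s)) (at s)"
proof -
  define Hy where "Hy = (\<lambda>x. frechet_derivative H (at x) (0, 1))"
  have cont: "continuous_on D H" using assms(3) by (rule Ck_on_imp_continuous_on)
  have conty: "continuous_on D Hy" using assms(3) by (simp add: Hy_def)
  have der: "(H has_derivative frechet_derivative H (at x)) (at x)" if "x \<in> D" for x
    using Ck_on_SucD[of 0 D H] assms(3) that by simp
  obtain r where r: "r > 0" "{-r..r} \<times> {-r..r} \<subseteq> D"
    using open_contains_square[OF assms(1,2)] .
  define Q where "Q = {-r..r} \<times> {-r..r}"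
  have QD: "Q \<subseteq> D" using r(2) by (simp add: Q_def)
  have "compact Q" by (simp add: Q_def compact_Times)
  have "bounded (H ` Q)" "bounded (Hy ` Q)"
    using \<open>compact Q\<close> QD cont conty continuous_on_subset
    by (blast intro: compact_imp_bounded compact_continuous_image)+
  then obtain M L where M: "\<And>x. x \<in> Q \<Longrightarrow> \<bar>H x\<bar> \<le> M" and L: "\<And>x. x \<in> Q \<Longrightarrow> \<bar>Hy x\<bar> \<le> L"
    by (auto simp: bounded_iff)
  have "(0, 0) \<in> Q" using r by (auto simp: Q_def)
  then have ML0: "M \<ge> 0" "L \<ge> 0" using M[of "(0,0)"] L[of "(0,0)"] by auto
  have lip: "\<bar>H (s, y) - H (s, y')\<bar> \<le> L * \<bar>y - y'\<bar>"
    if "s \<in> {-r..r}" "y \<in> {-r..r}" "y' \<in> {-r..r}" for s y y'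
  proof -
    have "((\<lambda>y. H (s, y)) has_field_derivative Hy (s, x)) (at x within {-r..r})"
      if x: "x \<in> {-r..r}" for x
    proof -
      have sx: "(s, x) \<in> D" using x \<open>s \<in> {-r..r}\<close> QD by (auto simp: Q_def)
      have "((\<lambda>y. H (s, y)) has_derivative (\<lambda>v. frechet_derivative H (at (s, x)) (0, v))) (at x)"
        by (rule has_derivative_compose[where f="\<lambda>y. (s, y)" and g=H])
          (use der[OF sx] in \<open>auto intro!: derivative_eq_intros\<close>)
      moreover have "frechet_derivative H (at (s, x)) (0, v) = Hy (s, x) * v" for v
        using linear_scale[OF has_derivative_linear[OF der[OF sx]], of v "(0, 1)"]
        by (simp add: Hy_def)
      ultimately show ?thesis
        by (auto simp: has_field_derivative_def intro: has_derivative_at_withinI)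
    qed
    then have "norm (H (s, y) - H (s, y')) \<le> L * norm (y - y')"
      by (rule field_differentiable_bound[rotated]) (use that L in \<open>auto simp: Q_def\<close>)
    then show ?thesis by simp
  qed
  \<comment> \<open>Integration runs over a length of at most \<open>2 * \<delta>\<close>: the
    second bound keeps the iterates within \<open>r\<close>, the third gives the contraction factor
    1/2. The added 1 keeps the denominators positive when \<open>M\<close> or \<open>L\<close> is
    0.\<close>
  define \<delta> where "\<delta> = min r (min (r / (2 * M + 1)) (1 / (4 * L + 1)))"
  have \<delta>: "\<delta> > 0" "\<delta> \<le> r" using r ML0 by (auto simp: \<delta>_def)
  have \<delta>M: "2 * \<delta> * M \<le> r"
  proof -
    have "\<delta> * (2 * M + 1) \<le> r"
      using ML0 mult_right_mono[of \<delta> "r / (2 * M + 1)" "2 * M + 1"] by (simp add: \<delta>_def)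
    then show ?thesis using \<delta> by (simp add: algebra_simps)
  qed
  have \<delta>L: "2 * \<delta> * L \<le> 1 / 2"
  proof -
    have "\<delta> * (4 * L + 1) \<le> 1"
      using ML0 mult_right_mono[of \<delta> "1 / (4 * L + 1)" "4 * L + 1"] by (simp add: \<delta>_def)
    then show ?thesis using \<delta> by (simp add: algebra_simps)
  qed
  \<comment> \<open>\<open>c\<close> clamps values to \<open>{-r..r}\<close> without increasing
    distances; \<open>d\<close> clamps times to \<open>{-\<delta>..\<delta>}\<close>.\<close>
  define c where "c = (\<lambda>y::real. max (-r) (min r y))"
  define d where "d = (\<lambda>s::real. max (-\<delta>) (min \<delta> s))"
  have c: "c y \<in> {-r..r}" "\<bar>c y - c y'\<bar> \<le> \<bar>y - y'\<bar>" for y y' using r by (auto simp: c_def)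
  have d: "d s \<in> {-\<delta>..\<delta>}" for s using \<delta> by (auto simp: d_def)
  have cc: "continuous_on T c" for T unfolding c_def by (intro continuous_intros)
  have dc: "continuous_on UNIV d" unfolding d_def by (intro continuous_intros)
  define g where "g = (\<lambda>(z::real \<Rightarrow> real) t. H (t, c (z t)))"
  define P where "P = (\<lambda>z s. integral {-\<delta>..d s} (g z))"
  have inQ: "(t, c y) \<in> Q" if "t \<in> {-\<delta>..\<delta>}" for t y
    using that c[of y] \<delta> by (auto simp: Q_def)
  have gc: "continuous_on {-\<delta>..\<delta>} (g z)" if "continuous_on UNIV z" for z
    unfolding g_def
    by (rule continuous_on_compose2[OF cont])
      (use that inQ QD in \<open>auto intro!: continuous_on_Pair continuous_on_id
        continuous_on_compose2[OF cc[of UNIV]] intro: continuous_on_subset\<close>)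
  have gi: "g z integrable_on {-\<delta>..d s}" if "continuous_on UNIV z" for z s
    using d[of s] by (intro integrable_continuous_real continuous_on_subset[OF gc[OF that]]) auto
  have PM: "\<bar>P z s\<bar> \<le> 2 * \<delta> * M" if "continuous_on UNIV z" for z s
  proof -
    have "norm (integral {-\<delta>..d s} (g z)) \<le> M * (d s - (-\<delta>))"
      using d[of s] M inQ continuous_on_subset[OF gc[OF that], of "{-\<delta>..d s}"]
      by (intro integral_bound) (auto simp: g_def)
    also have "\<dots> \<le> M * (2 * \<delta>)" using d[of s] ML0 by (intro mult_left_mono) auto
    finally show ?thesis by (simp add: P_def mult_ac)
  qed
  have Pb: "P z \<in> bcontfun" if z: "continuous_on UNIV z" for z
  proof -
    have "continuous_on {-\<delta>..\<delta>} (\<lambda>x. integral {-\<delta>..x} (g z))"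
      by (intro indefinite_integral_continuous_1 integrable_continuous_real gc z)
    then have "continuous_on UNIV (P z)"
      unfolding P_def by (rule continuous_on_compose2[OF _ dc]) (use d in auto)
    then show ?thesis using PM[OF z] by (auto simp: bcontfun_def bounded_iff)
  qed
  define T where "T = (\<lambda>z. Bcontfun (P (apply_bcontfun z)))"
  have T: "apply_bcontfun (T z) = P (apply_bcontfun z)" for z
    unfolding T_def by (intro Bcontfun_inverse Pb) simp
  have "dist (T z) (T z') \<le> 1 / 2 * dist z z'" for z z'
  proof (rule dist_bound)
    fix s
    have "dist (P z s) (P z' s) = norm (integral {-\<delta>..d s} (\<lambda>t. g z t - g z' t))"
      by (simp add: P_def dist_norm integral_diff gi)
    also have "\<dots> \<le> (L * dist z z') * (d s - (-\<delta>))"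
    proof (rule integral_bound)
      fix t assume "t \<in> {-\<delta>..d s}"
      then have t: "t \<in> {-r..r}" using d[of s] \<delta> by auto
      have "\<bar>c (z t) - c (z' t)\<bar> \<le> dist z z'"
        using c(2)[of "z t" "z' t"] dist_bounded[of z t z'] by (simp add: dist_real_def)
      then have "L * \<bar>c (z t) - c (z' t)\<bar> \<le> L * dist z z'" using ML0 by (intro mult_left_mono)
      then show "norm (g z t - g z' t) \<le> L * dist z z'"
        using lip[OF t c(1) c(1), of "z t" "z' t"] by (simp add: g_def)
    qed (use d[of s] in \<open>auto intro!: continuous_on_diff continuous_on_subset[OF gc]\<close>)
    also have "\<dots> \<le> (L * dist z z') * (2 * \<delta>)"
      using d[of s] ML0 by (intro mult_left_mono) auto
    also have "\<dots> \<le> 1 / 2 * dist z z'"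
      using mult_right_mono[OF \<delta>L, of "dist z z'"] by (simp add: mult_ac)
    finally show "dist (T z s) (T z' s) \<le> 1 / 2 * dist z z'" by (simp add: T)
  qed
  then obtain \<phi> where \<phi>: "T \<phi> = \<phi>"
    using banach_fix_type[of "1/2" T] by auto
  define z where "z = apply_bcontfun \<phi>"
  have zc: "continuous_on UNIV z" by (simp add: z_def)
  have zP: "z s = P z s" for s using T[of \<phi>] \<phi> by (simp add: z_def)
  have zr: "\<bar>z s\<bar> \<le> r" for s using zP PM[OF zc, of s] \<delta>M by simp
  \<comment> \<open>The a priori bound on the fixed point makes the clamp on values inactive, so the
    original right-hand side is recovered.\<close>
  have cz: "c (z s) = z s" for s using zr[of s] by (auto simp: c_def max_def min_def)
  show ?thesis
  proof
    fix s assume s: "s \<in> {-\<delta><..<\<delta>}"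
    show "(s, z s) \<in> D" using inQ[of s "z s"] s QD cz by auto
    have "((\<lambda>x. integral {-\<delta>..x} (g z)) has_real_derivative g z s) (at s within {-\<delta>..\<delta>})"
      using s by (intro integral_has_real_derivative gc zc) auto
    then have "((\<lambda>x. integral {-\<delta>..x} (g z)) has_real_derivative g z s) (at s)"
      using s at_within_Icc_at[of "-\<delta>" s \<delta>] by simp
    \<comment> \<open>Near an interior time \<open>d\<close> is the identity, so \<open>z\<close>
      coincides there with the indefinite integral.\<close>
    then show "(z has_real_derivative H (s, z s)) (at s)"
    proof (rule DERIV_cong_ev[THEN iffD1, rotated -1])
      show "\<forall>\<^sub>F x in nhds s. integral {-\<delta>..x} (g z) = z x"
        using eventually_nhds_in_open[of "{-\<delta><..<\<delta>}" s] s
        by (auto elim!: eventually_mono simp: zP[of _] P_def d_def)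
      show "g z s = H (s, z s)" by (simp add: g_def cz)
    qed simp
  qed (rule \<delta>)
qed

text \<open>Bootstrapping: if \<open>z\<close> is of class \<open>Ck_on k\<close>, then so is its
  derivative \<open>H (s, z s)\<close>, and \<open>z\<close> gains one order.\<close>

lemma smooth_on_ode_solution:
  fixes H :: "real \<times> real \<Rightarrow> real"
  assumes "smooth_on D H" "open S" "\<And>s. s \<in> S \<Longrightarrow> (s, z s) \<in> D"
    and "\<And>s. s \<in> S \<Longrightarrow> (z has_real_derivative H (s, z s)) (at s)"
  shows "smooth_on S z"
proof (rule smooth_onI)
  fix k
  show "Ck_on k S z"
  proof (induction k)
    case 0
    have "isCont z s" if "s \<in> S" for s using assms(4)[OF that] DERIV_isCont by blast
    then show ?case by (auto intro: continuous_at_imp_continuous_on)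
  next
    case (Suc k)
    have "Ck_on k S (\<lambda>s. (s, 0) + (0, z s))"
      by (intro Ck_on_add Ck_on_linear_compose[of "\<lambda>y. (y, 0)"] Ck_on_linear_compose[of "\<lambda>y. (0, y)"])
        (auto intro!: bounded_linear_Pair bounded_linear_ident bounded_linear_zero Ck_on_id assms Suc)
    then have "Ck_on k S (\<lambda>s. (s, z s))" by simp
    then have "Ck_on k S (\<lambda>s. H (s, z s))"
      using assms(3) Ck_on_compose[OF assms(2) _ smooth_onD[OF assms(1)], of "\<lambda>s. (s, z s)" k]
      by auto
    with assms(2,4) show ?case by (rule Ck_on_real_SucI)
  qed
qed

text \<open>An antiderivative solves an equation whose right-hand side does not involve the unknown,
  so the bootstrap for solutions gives its smoothness.\<close>

lemma smooth_antiderivative: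
  fixes f :: "real \<Rightarrow> real"
  assumes "smooth_on S f" "{a..b} \<subseteq> S"
  obtains F where "smooth_on {a<..<b} F"
    "\<And>s. s \<in> {a<..<b} \<Longrightarrow> (F has_real_derivative f s) (at s)"
proof -
  obtain F where F: "\<And>s. s \<in> {a..b} \<Longrightarrow> (F has_vector_derivative f s) (at s within {a..b})"
    using antiderivative_continuous[of a b f] continuous_on_subset[OF smooth_on_imp_continuous_on] assms
    by metis
  have F': "(F has_real_derivative f s) (at s)" if "s \<in> {a<..<b}" for s
    using F[of s] that at_within_Icc_at[of a s b]
    by (auto simp: has_real_derivative_iff_has_vector_derivative)
  have "smooth_on ({a<..<b} \<times> UNIV) (\<lambda>x. f (fst x))"
    by (rule smooth_on_compose[OF assms(1)])
      (use assms(2) in \<open>auto intro!: smooth_on_intros open_Times\<close>)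
  from smooth_on_ode_solution[OF this, of "{a<..<b}" F] F' have "smooth_on {a<..<b} F" by simp
  then show ?thesis using that F' by blast
qed

section \<open>Profile curves of spiral surfaces\<close>

text \<open>Pointwise algebra behind the profile, with \<open>i = 1 / \<alpha>\<^sup>2\<close>,
  \<open>n = 1 / (1 + \<alpha>\<^sup>2)\<close> and \<open>u = a' / (2 * a)\<close> in mind. Up to
  the factor \<open>exp (- 2 * K)\<close>, the spiral metric has the coefficients \<open>q\<close>,
  \<open>B\<close> and \<open>K'\<^sup>2 * n + (z' - K' * z)\<^sup>2\<close>. Since
  \<open>u + \<beta>\<close> is to be \<open>b * k / a\<close>, the two identities are the
  conditions on \<open>b\<close> and \<open>c\<close>.\<close>

lemma spiral_metric_algebra:
  fixes \<beta> i n q z z' K' R D u h' :: real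
  assumes n: "(i + 1) * n = i" and q: "q = 1 + z\<^sup>2" and K': "K' = \<beta> * (i + 1) * q"
    and z': "z' = q * (\<beta> * z - R)" and R: "R\<^sup>2 = D - i * \<beta>\<^sup>2 * q" and h': "h' = u + K' - z * z' / q"
  defines "B \<equiv> - K' * n + z * (z' - K' * z)"
  shows "q * h' + B = q * (u + \<beta>)"
    and "q * h'\<^sup>2 + 2 * B * h' + (K'\<^sup>2 * n + (z' - K' * z)\<^sup>2) = q * ((u + \<beta>)\<^sup>2 + D)"
proof -
  have q0: "q > 0" using q by (simp add: add_pos_nonneg)
  define \<zeta> where "\<zeta> = z' - K' * z"
  have Kn: "K' * n = \<beta> * i * q" using n K' by (simp add: mult.assoc mult.left_commute)
  have "q * h' = q * u + q * K' - z * z'" using q0 h' by (simp add: field_simps)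
  then have "q * h' + B = q * u + K' - K' * n" by (simp add: B_def q power2_eq_square algebra_simps)
  then show 1: "q * h' + B = q * (u + \<beta>)" unfolding Kn by (simp add: K' algebra_simps)
  have \<zeta>: "\<zeta> = - q * (R + i * \<beta> * z)" by (simp add: \<zeta>_def z' K' algebra_simps)
  have B: "B = - \<beta> * i * q + z * \<zeta>" using Kn by (simp add: B_def \<zeta>_def)
  have KKn: "K'\<^sup>2 * n = \<beta>\<^sup>2 * i * (i + 1) * q\<^sup>2"
  proof -
    have "K'\<^sup>2 * n = K' * (K' * n)" by (simp add: power2_eq_square)
    then show ?thesis unfolding Kn by (simp add: power2_eq_square K' mult_ac)
  qed
  \<comment> \<open>The choice of \<open>R\<close> gives the profile form the determinant
    \<open>q\<^sup>2 * D\<close>. Multiplying the second identity by \<open>q\<close> and completing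
    the square then reduces it to the first.\<close>
  have "q * (K'\<^sup>2 * n + \<zeta>\<^sup>2) - B\<^sup>2 = q\<^sup>2 * (\<beta>\<^sup>2 * i * (i + 1) * q + R\<^sup>2 - \<beta>\<^sup>2 * i\<^sup>2 * q)"
    unfolding KKn B \<zeta> unfolding q by algebra
  also have "\<dots> = q\<^sup>2 * D" unfolding R by algebra
  finally have 2: "q * (K'\<^sup>2 * n + \<zeta>\<^sup>2) = B\<^sup>2 + q\<^sup>2 * D" by simp
  have "q * (q * h'\<^sup>2 + 2 * B * h' + (K'\<^sup>2 * n + \<zeta>\<^sup>2)) = (q * h' + B)\<^sup>2 + q\<^sup>2 * D"
    using 2 by (simp add: algebra_simps power2_eq_square)
  also have "\<dots> = q * (q * ((u + \<beta>)\<^sup>2 + D))"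
    unfolding 1 by (simp add: algebra_simps power2_eq_square)
  finally show "q * h'\<^sup>2 + 2 * B * h' + (K'\<^sup>2 * n + (z' - K' * z)\<^sup>2) = q * ((u + \<beta>)\<^sup>2 + D)"
    using q0 by (simp add: \<zeta>_def)
qed

text \<open>Says that \<open>spiral_map \<alpha> \<rho> w\<close>, precomposed with \<open>(\<tau>, s) \<mapsto> (k * \<tau> + h s, s)\<close>, induces the metric
  \<open>exp (2 * k * \<tau>) * (a d\<tau>\<^sup>2 + 2 b d\<tau> ds + c ds\<^sup>2)\<close>.\<close>

definition spiral_profile ::
  "real set \<Rightarrow> real \<Rightarrow> (real \<Rightarrow> real) \<Rightarrow> (real \<Rightarrow> real) \<Rightarrow> (real \<Rightarrow> real) \<Rightarrow>
   real \<Rightarrow> (real \<Rightarrow> real) \<Rightarrow> (real \<Rightarrow> real) \<Rightarrow> (real \<Rightarrow> real) \<Rightarrow>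
   (real \<Rightarrow> real) \<Rightarrow> (real \<Rightarrow> real) \<Rightarrow> (real \<Rightarrow> real) \<Rightarrow> bool"
where
  "spiral_profile J k a b c \<alpha> \<rho> w h \<rho>' w' h' \<longleftrightarrow>
     smooth_on J \<rho> \<and> smooth_on J w \<and> smooth_on J h \<and>
     (\<forall>s\<in>J. (\<rho> has_real_derivative \<rho>' s) (at s) \<and> (w has_real_derivative w' s) (at s) \<and>
        (h has_real_derivative h' s) (at s) \<and>
        exp (2 * h s) * (k\<^sup>2 * ((1 + \<alpha>\<^sup>2) * (\<rho> s)\<^sup>2 + (w s)\<^sup>2)) = a s \<and>
        exp (2 * h s) *
          (k * (((1 + \<alpha>\<^sup>2) * (\<rho> s)\<^sup>2 + (w s)\<^sup>2) * h' s + (\<rho> s * \<rho>' s + w s * w' s))) = b s \<and>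
        exp (2 * h s) *
          (((1 + \<alpha>\<^sup>2) * (\<rho> s)\<^sup>2 + (w s)\<^sup>2) * (h' s)\<^sup>2 + 2 * (\<rho> s * \<rho>' s + w s * w' s) * h' s
           + ((\<rho>' s)\<^sup>2 + (w' s)\<^sup>2)) = c s)"

text \<open>The equation for \<open>a\<close> determines \<open>h\<close>, the one for
  \<open>b\<close> then forces \<open>K'\<close>, and the one for \<open>c\<close> becomes quadratic
  in \<open>z'\<close>; \<open>H\<close> is one of its roots. Thus an ordinary differential equation
  for \<open>z\<close> and a quadrature for \<open>K\<close> produce the profile.\<close>

lemma spiral_profile_exists:
  fixes a b c :: "real \<Rightarrow> real"
  assumes k: "k \<noteq> 0" and S: "open S" "0 \<in> S"
    and sm: "smooth_on S a" "smooth_on S b" "smooth_on S c"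
    and pos: "\<And>s. s \<in> S \<Longrightarrow> a s > 0" "\<And>s. s \<in> S \<Longrightarrow> a s * c s - (b s)\<^sup>2 > 0"
  obtains \<delta> \<alpha> \<rho> w h \<rho>' w' h' where "\<delta> > 0" "\<alpha> \<noteq> 0" "{-\<delta><..<\<delta>} \<subseteq> S"
    "spiral_profile {-\<delta><..<\<delta>} k a b c \<alpha> \<rho> w h \<rho>' w' h'"
proof -
  define a' where "a' = (\<lambda>s. frechet_derivative a (at s) 1)"
  have a': "(a has_real_derivative a' s) (at s)" if "s \<in> S" for s
  proof -
    note d = smooth_on_has_derivative[OF sm(1) that]
    have "frechet_derivative a (at s) v = a' s * v" for v
      using linear_scale[OF has_derivative_linear[OF d], of v 1] by (simp add: a'_def)
    then have "frechet_derivative a (at s) = (*) (a' s)" by blast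
    then show ?thesis using d by (simp add: has_field_derivative_def)
  qed
  have sma': "smooth_on S a'" by (rule smooth_on_real_derivative[OF S(1) a' sm(1)])
  define \<beta> where "\<beta> = (\<lambda>s. (b s * k - a' s / 2) / a s)"
  define D where "D = (\<lambda>s. (a s * c s - (b s)\<^sup>2) * k\<^sup>2 / (a s)\<^sup>2)"
  have sm\<beta>: "smooth_on S \<beta>"
    unfolding \<beta>_def by (intro smooth_on_intros S sm sma' pos(1)) auto
  have smD: "smooth_on S D"
    unfolding D_def by (intro smooth_on_intros S sm) (use pos(1) in fastforce)
  have Dpos: "D s > 0" if "s \<in> S" for s
    using pos[OF that] k by (simp add: D_def)
  \<comment> \<open>This choice gives
    \<open>\<alpha>\<^sup>2 * D 0 = 2 * (\<beta> 0)\<^sup>2 + D 0\<close>, which exceeds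
    \<open>(\<beta> 0)\<^sup>2\<close>, so the radicand is positive at the origin. The summand 1
    keeps \<alpha> nonzero even if \<open>\<beta> 0\<close> vanishes.\<close>
  define \<alpha> where "\<alpha> = sqrt (2 * (\<beta> 0)\<^sup>2 / D 0 + 1)"
  have \<alpha>2: "\<alpha>\<^sup>2 = 2 * (\<beta> 0)\<^sup>2 / D 0 + 1"
    unfolding \<alpha>_def using Dpos[OF S(2)] by (simp add: less_imp_le)
  have \<alpha>pos: "\<alpha>\<^sup>2 > 0" unfolding \<alpha>2 using Dpos[OF S(2)] by (simp add: add_nonneg_pos)
  then have m0: "1 + \<alpha>\<^sup>2 > 0" "1 + \<alpha>\<^sup>2 \<noteq> 0" by linarith+
  define i where "i = 1 / \<alpha>\<^sup>2"
  define n where "n = 1 / (1 + \<alpha>\<^sup>2)"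
  have n: "(i + 1) * n = i" using \<alpha>pos m0 by (simp add: i_def n_def field_simps)
  have n0: "n > 0" using m0 by (simp add: n_def)
  have nm: "(1 + \<alpha>\<^sup>2) * n = 1" using m0 by (simp add: n_def)
  define rad where "rad = (\<lambda>x. D (fst x) - i * (\<beta> (fst x))\<^sup>2 * (1 + (snd x)\<^sup>2))"
  define H where "H = (\<lambda>x. (1 + (snd x)\<^sup>2) * (\<beta> (fst x) * snd x - sqrt (rad x)))"
  \<comment> \<open>\<open>H\<close> is smooth only where the radicand is positive; this open set is
    the domain given to the existence lemma, which keeps the solution inside it.\<close>
  define T where "T = {x \<in> S \<times> UNIV. rad x > 0}"
  have SU: "open (S \<times> (UNIV :: real set))" using S by (intro open_Times) auto
  have c1: "smooth_on X (\<lambda>x. f (fst x))" if "smooth_on S f" "open X" "X \<subseteq> S \<times> UNIV" for f X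
    by (rule smooth_on_compose[OF that(1)]) (use that in \<open>auto intro!: smooth_on_intros\<close>)
  have rad: "smooth_on X rad" if "open X" "X \<subseteq> S \<times> UNIV" for X
    unfolding rad_def by (intro smooth_on_intros c1 sm\<beta> smD that)
  have "T = (S \<times> UNIV) \<inter> rad -` {0<..}" by (auto simp: T_def)
  then have T: "open T"
    using continuous_open_preimage[OF smooth_on_imp_continuous_on[OF rad[OF SU subset_refl]] SU, of "{0<..}"]
    by simp
  have TS: "T \<subseteq> S \<times> UNIV" by (auto simp: T_def)
  have smH: "smooth_on T H"
    unfolding H_def by (intro smooth_on_intros c1 sm\<beta> rad T TS) (auto simp: T_def)
  have "i * (\<beta> 0)\<^sup>2 < D 0"
  proof -
    have "\<alpha>\<^sup>2 * D 0 = 2 * (\<beta> 0)\<^sup>2 + D 0" using Dpos[OF S(2)] unfolding \<alpha>2 by (simp add: field_simps)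
    then have "(\<beta> 0)\<^sup>2 < \<alpha>\<^sup>2 * D 0" using Dpos[OF S(2)] zero_le_power2[of "\<beta> 0"] by linarith
    then show ?thesis using \<alpha>pos by (simp add: i_def field_simps)
  qed
  then have "(0, 0) \<in> T" using S(2) by (simp add: T_def rad_def)
  then obtain \<epsilon> z where \<epsilon>: "\<epsilon> > 0" and zT: "\<And>s. s \<in> {-\<epsilon><..<\<epsilon>} \<Longrightarrow> (s, z s) \<in> T"
    and z': "\<And>s. s \<in> {-\<epsilon><..<\<epsilon>} \<Longrightarrow> (z has_real_derivative H (s, z s)) (at s)"
    using scalar_ode_local_solution[OF T _ smooth_onD[OF smH]] by metis
  have smz: "smooth_on {-\<epsilon><..<\<epsilon>} z" by (rule smooth_on_ode_solution[OF smH _ zT z']) simp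
  have sub: "{-\<epsilon><..<\<epsilon>} \<subseteq> S" using zT unfolding T_def by fastforce
  define K' where "K' = (\<lambda>s. \<beta> s * (i + 1) * (1 + (z s)\<^sup>2))"
  have smK': "smooth_on {-\<epsilon><..<\<epsilon>} K'"
    unfolding K'_def by (intro smooth_on_intros smooth_on_subset[OF sm\<beta>] smz sub) auto
  \<comment> \<open>Halving the interval puts the closed interval inside the domain of
    \<open>K'\<close>, as the quadrature requires.\<close>
  define \<delta> where "\<delta> = \<epsilon> / 2"
  define J where "J = {-\<delta><..<\<delta>}"
  have "{-\<delta>..\<delta>} \<subseteq> {-\<epsilon><..<\<epsilon>}" using \<epsilon> by (auto simp: \<delta>_def)
  then obtain K where smK: "smooth_on J K"
    and dK: "\<And>s. s \<in> J \<Longrightarrow> (K has_real_derivative K' s) (at s)"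
    using smooth_antiderivative[OF smK', of "-\<delta>" \<delta>] unfolding J_def by metis
  have JE: "J \<subseteq> {-\<epsilon><..<\<epsilon>}" using \<epsilon> by (auto simp: \<delta>_def J_def)
  have JS: "J \<subseteq> S" using JE sub by blast
  have oJ: "open J" by (simp add: J_def)
  have smz: "smooth_on J z" using smz JE by (rule smooth_on_subset)
  define z' where "z' = (\<lambda>s. H (s, z s))"
  have dz: "(z has_real_derivative z' s) (at s)" if "s \<in> J" for s
    using z'[of s] that JE by (auto simp: z'_def)
  define u where "u = (\<lambda>s. a' s / a s / 2)"
  \<comment> \<open>The equation for \<open>a\<close> solved for \<open>h\<close>, using \<open>(1 +
    \<alpha>\<^sup>2) * (\<rho> s)\<^sup>2 + (w s)\<^sup>2 = exp (- 2 * K s) * (1 + (z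
    s)\<^sup>2)\<close>.\<close>
  define h where "h = (\<lambda>s. ln (a s / k\<^sup>2) / 2 + K s - ln (1 + (z s)\<^sup>2) / 2)"
  define h' where "h' = (\<lambda>s. u s + K' s - z s * z' s / (1 + (z s)\<^sup>2))"
  define \<rho> where "\<rho> = (\<lambda>s. sqrt n * exp (- K s))"
  define w where "w = (\<lambda>s. exp (- K s) * z s)"
  define \<rho>' where "\<rho>' = (\<lambda>s. - K' s * \<rho> s)"
  define w' where "w' = (\<lambda>s. exp (- K s) * (z' s - K' s * z s))"
  have q0: "1 + (z s)\<^sup>2 > 0" for s by (simp add: add_pos_nonneg)
  have smaJ: "smooth_on J a" using sm(1) JS by (rule smooth_on_subset)
  have sm\<rho>: "smooth_on J \<rho>" unfolding \<rho>_def by (intro smooth_on_intros smK oJ)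
  have smw: "smooth_on J w" unfolding w_def by (intro smooth_on_intros smK smz oJ)
  have smh: "smooth_on J h"
    unfolding h_def using pos(1) JS q0 k
    by (intro smooth_on_intros smK smz smaJ oJ) auto
  have d\<rho>: "(\<rho> has_real_derivative \<rho>' s) (at s)" if "s \<in> J" for s
    unfolding \<rho>_def \<rho>'_def by (auto intro!: derivative_eq_intros dK[OF that])
  have dw: "(w has_real_derivative w' s) (at s)" if "s \<in> J" for s
    unfolding w_def w'_def
    by (auto intro!: derivative_eq_intros dK[OF that] dz[OF that] simp: algebra_simps)
  have dh: "(h has_real_derivative h' s) (at s)" if s: "s \<in> J" for s
  proof -
    have as: "a s > 0" "(a has_real_derivative a' s) (at s)" using s JS pos(1) a' by auto
    have "((\<lambda>s. ln (a s / k\<^sup>2)) has_real_derivative a' s / a s) (at s)"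
      using DERIV_chain2[OF DERIV_ln DERIV_cdivide[OF as(2)], of "k\<^sup>2"] as k
      by (simp add: divide_simps)
    moreover define t where "t = z s * z' s / (1 + (z s)\<^sup>2)"
    have "((\<lambda>s. ln (1 + (z s)\<^sup>2)) has_real_derivative t * 2) (at s)"
      unfolding t_def using q0[of s] by (auto intro!: derivative_eq_intros dz[OF s])
    ultimately have "(h has_real_derivative
        a' s / a s / 2 + K' s - t * 2 / 2) (at s)"
      unfolding h_def by (intro DERIV_add DERIV_diff DERIV_cdivide dK[OF s])
    then show ?thesis by (simp add: h'_def u_def flip: t_def)
  qed
  have main:
    "exp (2 * h s) * (k\<^sup>2 * ((1 + \<alpha>\<^sup>2) * (\<rho> s)\<^sup>2 + (w s)\<^sup>2)) = a s \<and>
     exp (2 * h s) * (k * (((1 + \<alpha>\<^sup>2) * (\<rho> s)\<^sup>2 + (w s)\<^sup>2) * h' s + (\<rho> s * \<rho>' s + w s * w' s))) = b s \<and>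
     exp (2 * h s) * (((1 + \<alpha>\<^sup>2) * (\<rho> s)\<^sup>2 + (w s)\<^sup>2) * (h' s)\<^sup>2 + 2 * (\<rho> s * \<rho>' s + w s * w' s) * h' s
        + ((\<rho>' s)\<^sup>2 + (w' s)\<^sup>2)) = c s"
    if s: "s \<in> J" for s
  proof -
    have as: "a s > 0" using s JS pos(1) by auto
    define q where "q = 1 + (z s)\<^sup>2"
    \<comment> \<open>All three coefficients of the profile metric carry this factor; what remains
      after removing it is the subject of \<open>spiral_metric_algebra\<close>.\<close>
    define P where "P = (exp (- K s))\<^sup>2"
    define B where "B = - K' s * n + z s * (z' s - K' s * z s)"
    have "exp (2 * h s) = exp (ln (a s / k\<^sup>2)) * (exp (K s))\<^sup>2 / exp (ln q)"
      unfolding h_def q_def by (simp add: exp_add exp_diff power2_eq_square flip: exp_double exp_add) 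
    then have e2h: "exp (2 * h s) * P = a s / k\<^sup>2 / q"
      using as k q0[of s] by (simp add: P_def q_def exp_minus field_simps)
    have \<rho>2: "(\<rho> s)\<^sup>2 = n * P" using n0 by (simp add: \<rho>_def P_def power_mult_distrib)
    have "(1 + \<alpha>\<^sup>2) * (\<rho> s)\<^sup>2 = P"
      unfolding \<rho>2 mult.assoc[symmetric] nm by simp
    then have A: "(1 + \<alpha>\<^sup>2) * (\<rho> s)\<^sup>2 + (w s)\<^sup>2 = P * q"
      by (simp add: w_def P_def q_def power_mult_distrib distrib_left)
    have "\<rho> s * \<rho>' s = - K' s * (n * P)"
      unfolding \<rho>2[symmetric] by (simp add: \<rho>'_def power2_eq_square)
    then have BB: "\<rho> s * \<rho>' s + w s * w' s = P * B"
      by (simp add: w_def w'_def B_def P_def power2_eq_square algebra_simps)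
    have "(\<rho>' s)\<^sup>2 = (K' s)\<^sup>2 * (n * P)"
      unfolding \<rho>2[symmetric] by (simp add: \<rho>'_def power_mult_distrib)
    moreover have "(w' s)\<^sup>2 = P * (z' s - K' s * z s)\<^sup>2"
      by (simp add: w'_def P_def power_mult_distrib)
    ultimately have C: "(\<rho>' s)\<^sup>2 + (w' s)\<^sup>2 = P * ((K' s)\<^sup>2 * n + (z' s - K' s * z s)\<^sup>2)"
      by (simp add: distrib_left mult_ac)
    have "rad (s, z s) > 0" using zT[of s] s JE by (auto simp: T_def)
    then have R: "(sqrt (rad (s, z s)))\<^sup>2 = D s - i * (\<beta> s)\<^sup>2 * q"
      by (simp add: rad_def q_def)
    have z's: "z' s = q * (\<beta> s * z s - sqrt (rad (s, z s)))" by (simp add: z'_def H_def q_def)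
    note alg = spiral_metric_algebra[OF n q_def _ z's R, of "K' s" "h' s" "u s", folded B_def]
    have alg1: "q * h' s + B = q * (u s + \<beta> s)"
      and alg2: "q * (h' s)\<^sup>2 + 2 * B * h' s + ((K' s)\<^sup>2 * n + (z' s - K' s * z s)\<^sup>2)
        = q * ((u s + \<beta> s)\<^sup>2 + D s)"
      by (rule alg; simp add: K'_def q_def h'_def)+
    have u\<beta>: "u s + \<beta> s = b s * k / a s" using as by (simp add: u_def \<beta>_def field_simps)
    have q1: "q > 0" using q0[of s] by (simp add: q_def)
    have "exp (2 * h s) * (k\<^sup>2 * (P * q)) = a s"
      using arg_cong[OF e2h, of "\<lambda>x. x * (k\<^sup>2 * q)"] k q1 by (simp add: mult_ac)
    moreover have "exp (2 * h s) * (k * (P * q * h' s + P * B)) = (exp (2 * h s) * P) * (k * (q * h' s + B))"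
      by (simp add: algebra_simps)
    then have "exp (2 * h s) * (k * (P * q * h' s + P * B)) = b s"
      unfolding e2h alg1 u\<beta> using k q1 as by (simp add: field_simps power2_eq_square)
    moreover have "exp (2 * h s) * (P * q * (h' s)\<^sup>2 + 2 * (P * B) * h' s
        + P * ((K' s)\<^sup>2 * n + (z' s - K' s * z s)\<^sup>2))
        = (exp (2 * h s) * P) * (q * (h' s)\<^sup>2 + 2 * B * h' s + ((K' s)\<^sup>2 * n + (z' s - K' s * z s)\<^sup>2))"
      by (simp add: algebra_simps)
    then have "exp (2 * h s) * (P * q * (h' s)\<^sup>2 + 2 * (P * B) * h' s
        + P * ((K' s)\<^sup>2 * n + (z' s - K' s * z s)\<^sup>2)) = c s"
      unfolding e2h alg2 u\<beta> D_def using k q1 as by (simp add: field_simps power2_eq_square)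
    ultimately show ?thesis unfolding A BB C by blast
  qed
  have "\<delta> > 0" using \<epsilon> by (simp add: \<delta>_def)
  moreover have "\<alpha> \<noteq> 0" using \<alpha>pos by auto
  moreover have "spiral_profile J k a b c \<alpha> \<rho> w h \<rho>' w' h'"
    unfolding spiral_profile_def using sm\<rho> smw smh d\<rho> dw dh main by blast
  ultimately show ?thesis using that JS unfolding J_def by blast
qed

section \<open>Isometric immersions as spiral surfaces\<close>

lemma vector_3_scaleR:
  "(vector [a, b, c] :: real^3) = a *\<^sub>R vector [1, 0, 0] + b *\<^sub>R vector [0, 1, 0] + c *\<^sub>R vector [0, 0, 1]"
  by (simp add: vec_eq_iff forall_3)

lemma inner_vector_3:
  "(vector [a, b, c] :: real^3) \<bullet> vector [a', b', c'] = a * a' + b * b' + c * c'"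
  by (simp add: inner_vec_def sum_3)

lemma smooth_on_vector_3:
  fixes f g h :: "'a::real_normed_vector \<Rightarrow> real"
  assumes "open S" "smooth_on S f" "smooth_on S g" "smooth_on S h"
  shows "smooth_on S (\<lambda>x. vector [f x, g x, h x] :: real^3)"
  unfolding vector_3_scaleR[of "f _"] by (intro smooth_on_intros assms)

lemma has_derivative_vector_3:
  fixes f g h :: "'a::real_normed_vector \<Rightarrow> real"
  assumes "(f has_derivative f') F" "(g has_derivative g') F" "(h has_derivative h') F"
  shows "((\<lambda>x. vector [f x, g x, h x] :: real^3) has_derivative (\<lambda>v. vector [f' v, g' v, h' v])) F"
  unfolding vector_3_scaleR[of "f _"] vector_3_scaleR[of "f' _"]
  by (intro has_derivative_add has_derivative_scaleR_left assms)

lemma spiral_map_alt: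
  "spiral_map \<alpha> \<rho> w = (\<lambda>x. vector [exp (fst x) * \<rho> (snd x) * cos (\<alpha> * fst x),
     exp (fst x) * \<rho> (snd x) * sin (\<alpha> * fst x), exp (fst x) * w (snd x)])"
  by (auto simp: spiral_map_def)

lemma smooth_on_spiral_map:
  assumes "open T" "open J" "smooth_on J \<rho>" "smooth_on J w"
  shows "smooth_on (T \<times> J) (spiral_map \<alpha> \<rho> w)"
proof -
  have o: "open (T \<times> J)" using assms by (intro open_Times)
  have "smooth_on (T \<times> J) (\<lambda>x. f (snd x))" if "smooth_on J f" for f :: "real \<Rightarrow> real"
    by (rule smooth_on_compose[OF that o smooth_on_snd[OF o smooth_on_id[OF o]]]) auto
  from this[OF assms(3)] this[OF assms(4)] show ?thesis
    unfolding spiral_map_alt by (intro smooth_on_vector_3 smooth_on_intros o)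
qed

text \<open>Only the inner products of the derivative matter later, so it is hidden behind them. The
  mixed terms of the radial and the angular part cancel between the first two components, and the
  squares of sine and cosine add up to 1, so no dependence on \<theta> is left except the factor
  \<open>exp (2 * \<theta>)\<close>.\<close>

lemma spiral_map_derivative:
  assumes \<rho>: "(\<rho> has_real_derivative \<rho>') (at s)" and w: "(w has_real_derivative w') (at s)"
  obtains D where "(spiral_map \<alpha> \<rho> w has_derivative D) (at (\<theta>, s))"
    "\<And>x y x' y'. D (x, y) \<bullet> D (x', y') = exp (2 * \<theta>) *
       (((1 + \<alpha>\<^sup>2) * (\<rho> s)\<^sup>2 + (w s)\<^sup>2) * (x * x') + (\<rho> s * \<rho>' + w s * w') * (x * y' + x' * y)
        + (\<rho>'\<^sup>2 + w'\<^sup>2) * (y * y'))"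
proof -
  let ?p = "(\<theta>, s)"
  define L where "L = (\<lambda>v::real \<times> real. \<rho> s * fst v + \<rho>' * snd v)"
  define C where "C = cos (\<alpha> * \<theta>)"
  define Z where "Z = sin (\<alpha> * \<theta>)"
  define D where "D = (\<lambda>v. vector [exp \<theta> * (L v * C - \<alpha> * \<rho> s * Z * fst v),
    exp \<theta> * (L v * Z + \<alpha> * \<rho> s * C * fst v), exp \<theta> * (w s * fst v + w' * snd v)] :: real^3)"
  have snd_der: "((\<lambda>x. f (snd x)) has_derivative (\<lambda>v. f' * snd v)) (at ?p)"
    if "(f has_real_derivative f') (at s)" for f f'
    by (rule has_derivative_compose[where f=snd and g=f])
      (use that in \<open>auto simp: has_field_derivative_def intro!: derivative_eq_intros\<close>)
  have "((\<lambda>x. exp (fst x) * \<rho> (snd x) * cos (\<alpha> * fst x)) has_derivative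
      (\<lambda>v. exp \<theta> * (L v * C - \<alpha> * \<rho> s * Z * fst v))) (at ?p)"
    by (rule derivative_eq_intros snd_der[OF \<rho>] refl)+
      (simp add: L_def C_def Z_def fun_eq_iff algebra_simps)
  moreover have "((\<lambda>x. exp (fst x) * \<rho> (snd x) * sin (\<alpha> * fst x)) has_derivative
      (\<lambda>v. exp \<theta> * (L v * Z + \<alpha> * \<rho> s * C * fst v))) (at ?p)"
    by (rule derivative_eq_intros snd_der[OF \<rho>] refl)+
      (simp add: L_def C_def Z_def fun_eq_iff algebra_simps)
  moreover have "((\<lambda>x. exp (fst x) * w (snd x)) has_derivative
      (\<lambda>v. exp \<theta> * (w s * fst v + w' * snd v))) (at ?p)"
    by (rule derivative_eq_intros snd_der[OF w] refl)+
      (simp add: fun_eq_iff algebra_simps)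
  ultimately have "(spiral_map \<alpha> \<rho> w has_derivative D) (at ?p)"
    unfolding spiral_map_alt D_def by (rule has_derivative_vector_3)
  moreover have "D (x, y) \<bullet> D (x', y') = exp (2 * \<theta>) *
       (((1 + \<alpha>\<^sup>2) * (\<rho> s)\<^sup>2 + (w s)\<^sup>2) * (x * x') + (\<rho> s * \<rho>' + w s * w') * (x * y' + x' * y)
        + (\<rho>'\<^sup>2 + w'\<^sup>2) * (y * y'))" for x y x' y'
  proof -
    have CZ: "C\<^sup>2 = 1 - Z\<^sup>2" by (simp add: C_def Z_def cos_squared_eq)
    have "D (x, y) \<bullet> D (x', y') = (exp \<theta>)\<^sup>2 *
      ((L (x, y) * L (x', y') + \<alpha>\<^sup>2 * (\<rho> s)\<^sup>2 * x * x') * (C\<^sup>2 + Z\<^sup>2) + (w s * x + w' * y) * (w s * x' + w' * y'))"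
      by (simp add: D_def inner_vector_3 power2_eq_square algebra_simps)
    then show ?thesis
      unfolding CZ exp_double by (simp add: L_def power2_eq_square algebra_simps)
  qed
  ultimately show ?thesis by (rule that)
qed

section \<open>Homothetic metrics in adapted coordinates\<close>

definition metric_form ::
  "(real \<times> real \<Rightarrow> real) \<Rightarrow> (real \<times> real \<Rightarrow> real) \<Rightarrow> (real \<times> real \<Rightarrow> real) \<Rightarrow>
   real \<times> real \<Rightarrow> real \<times> real \<Rightarrow> real \<times> real \<Rightarrow> real"
where "metric_form E F G p v w =
  E p * (fst v * fst w) + F p * (fst v * snd w + fst w * snd v) + G p * (snd v * snd w)"

text \<open>Multiplying the form by \<open>a\<close> turns it into
  \<open>(a * x + b * y)\<^sup>2 + (a * c - b\<^sup>2) * y\<^sup>2\<close>, a sum of nonnegative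
  terms.\<close>

lemma binary_form_zero:
  fixes a b c x y :: real
  assumes "a > 0" "a * c - b\<^sup>2 > 0" "a * (x * x) + b * (x * y + x * y) + c * (y * y) = 0"
  shows "x = 0 \<and> y = 0"
proof -
  have "(a * x + b * y)\<^sup>2 + (a * c - b\<^sup>2) * y\<^sup>2 = a * (a * (x * x) + b * (x * y + x * y) + c * (y * y))"
    by (simp add: power2_eq_square algebra_simps)
  then have 0: "(a * x + b * y)\<^sup>2 + (a * c - b\<^sup>2) * y\<^sup>2 = 0" using assms(3) by simp
  moreover have "(a * c - b\<^sup>2) * y\<^sup>2 \<ge> 0" using assms(2) by simp
  ultimately have "(a * c - b\<^sup>2) * y\<^sup>2 = 0" using zero_le_power2[of "a * x + b * y"] by linarith
  then have "y = 0" using assms(2) by simp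
  then show ?thesis using 0 assms(1) by simp
qed

text \<open>In the coordinates given by \<Psi> the immersion is the spiral map preceded by the shear
  \<open>\<eta> (\<tau>, s) = (k * \<tau> + h s, s)\<close>. The neighbourhood is cut down until its
  image is that of a full rectangle \<open>\<Theta> \<times> J0\<close>, as the notion of a Lie
  spiral surface demands.\<close>

lemma homothetic_metric_spiral_immersion:
  fixes \<Phi> \<Psi> :: "real \<times> real \<Rightarrow> real \<times> real" and a b c :: "real \<Rightarrow> real"
  assumes k: "k \<noteq> 0" and r: "r > 0" and B: "B = {-r<..<r} \<times> {-r<..<r}"
    and \<Phi>: "\<And>x. x \<in> B \<Longrightarrow> (\<Phi> has_derivative \<Phi>' x) (at x)"
    and V0: "V0 = \<Phi> ` B" "open V0" and \<Psi>: "smooth_on V0 \<Psi>" "\<And>x. x \<in> B \<Longrightarrow> \<Psi> (\<Phi> x) = x"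
    and sm: "smooth_on {-r<..<r} a" "smooth_on {-r<..<r} b" "smooth_on {-r<..<r} c"
    and pos: "\<And>s. s \<in> {-r<..<r} \<Longrightarrow> a s > 0" "\<And>s. s \<in> {-r<..<r} \<Longrightarrow> a s * c s - (b s)\<^sup>2 > 0"
    and g: "\<And>\<tau> s x y x' y'. (\<tau>, s) \<in> B \<Longrightarrow>
      metric_form E F G (\<Phi> (\<tau>, s)) (\<Phi>' (\<tau>, s) (x, y)) (\<Phi>' (\<tau>, s) (x', y'))
      = exp (2 * k * \<tau>) * (a s * (x * x') + b s * (x * y' + x' * y) + c s * (y * y'))"
  shows "\<exists>V f. open V \<and> \<Phi> (0, 0) \<in> V \<and> V \<subseteq> V0 \<and>
    isometric_immersion_on V E F G f \<and> lie_spiral_surface (f ` V)"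
proof -
  have o0: "open {-r<..<r}" "0 \<in> {-r<..<r}" using r by auto
  obtain \<delta> \<alpha> \<rho> w h \<rho>' w' h' where \<delta>: "\<delta> > 0" and \<alpha>: "\<alpha> \<noteq> 0" and J: "{-\<delta><..<\<delta>} \<subseteq> {-r<..<r}"
    and "spiral_profile {-\<delta><..<\<delta>} k a b c \<alpha> \<rho> w h \<rho>' w' h'"
    by (rule spiral_profile_exists[OF k o0 sm pos])
  then have sm\<rho>: "smooth_on {-\<delta><..<\<delta>} \<rho>" and smw: "smooth_on {-\<delta><..<\<delta>} w"
    and smh: "smooth_on {-\<delta><..<\<delta>} h"
    and d\<rho>: "\<And>s. s \<in> {-\<delta><..<\<delta>} \<Longrightarrow> (\<rho> has_real_derivative \<rho>' s) (at s)"
    and dw: "\<And>s. s \<in> {-\<delta><..<\<delta>} \<Longrightarrow> (w has_real_derivative w' s) (at s)"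
    and dh: "\<And>s. s \<in> {-\<delta><..<\<delta>} \<Longrightarrow> (h has_real_derivative h' s) (at s)"
    and eqa: "\<And>s. s \<in> {-\<delta><..<\<delta>} \<Longrightarrow>
      exp (2 * h s) * (k\<^sup>2 * ((1 + \<alpha>\<^sup>2) * (\<rho> s)\<^sup>2 + (w s)\<^sup>2)) = a s"
    and eqb: "\<And>s. s \<in> {-\<delta><..<\<delta>} \<Longrightarrow> exp (2 * h s) *
       (k * (((1 + \<alpha>\<^sup>2) * (\<rho> s)\<^sup>2 + (w s)\<^sup>2) * h' s + (\<rho> s * \<rho>' s + w s * w' s))) = b s"
    and eqc: "\<And>s. s \<in> {-\<delta><..<\<delta>} \<Longrightarrow> exp (2 * h s) *
       (((1 + \<alpha>\<^sup>2) * (\<rho> s)\<^sup>2 + (w s)\<^sup>2) * (h' s)\<^sup>2 + 2 * (\<rho> s * \<rho>' s + w s * w' s) * h' s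
        + ((\<rho>' s)\<^sup>2 + (w' s)\<^sup>2)) = c s"
    by (simp_all add: spiral_profile_def)
  define J where "J = {-\<delta><..<\<delta>}"
  define \<sigma> where "\<sigma> = spiral_map \<alpha> \<rho> w"
  define \<eta> where "\<eta> = (\<lambda>x. (k * fst x + h (snd x), snd x))"
  define \<eta>' where "\<eta>' = (\<lambda>s x. (k * fst x + h' s * snd x, snd x))"
  have oJ: "open J" by (simp add: J_def)
  have sm\<eta>: "smooth_on (UNIV \<times> J) \<eta>"
  proof -
    have o: "open ((UNIV :: real set) \<times> J)" using oJ by (intro open_Times) auto
    have "smooth_on ((UNIV :: real set) \<times> J) (\<lambda>x. h (snd x))"
      by (rule smooth_on_compose[OF smh[folded J_def] o smooth_on_snd[OF o smooth_on_id[OF o]]]) auto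
    then show ?thesis unfolding \<eta>_def by (intro smooth_on_intros o)
  qed
  have d\<eta>: "(\<eta> has_derivative \<eta>' s) (at (\<tau>, s))" if "s \<in> J" for \<tau> s
  proof -
    have "((\<lambda>x. h (snd x)) has_derivative (\<lambda>v. h' s * snd v)) (at (\<tau>, s))"
      by (rule has_derivative_compose[where f=snd and g=h])
        (use dh[of s] that in \<open>auto simp: J_def has_field_derivative_def intro!: derivative_eq_intros\<close>)
    then show ?thesis
      unfolding \<eta>_def \<eta>'_def by (auto intro!: derivative_eq_intros)
  qed
  define D\<sigma> where "D\<sigma> = (\<lambda>\<tau> s. frechet_derivative \<sigma> (at (\<eta> (\<tau>, s))))"
  \<comment> \<open>The equations in \<open>spiral_profile\<close> say exactly that the sheared
    spiral metric is the prescribed one; \<open>exp (2 * (k * \<tau> + h s))\<close> splits into the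
    homothety factor and the factor occurring in those equations.\<close>
  have D\<sigma>: "(\<sigma> has_derivative D\<sigma> \<tau> s) (at (\<eta> (\<tau>, s)))"
    and inner: "D\<sigma> \<tau> s (\<eta>' s (x, y)) \<bullet> D\<sigma> \<tau> s (\<eta>' s (x', y')) =
      exp (2 * k * \<tau>) * (a s * (x * x') + b s * (x * y' + x' * y) + c s * (y * y'))"
    if "s \<in> J" for \<tau> s x y x' y'
  proof -
    have s: "s \<in> {-\<delta><..<\<delta>}" using that by (simp add: J_def)
    obtain D where D: "(\<sigma> has_derivative D) (at (k * \<tau> + h s, s))"
      "\<And>x y x' y'. D (x, y) \<bullet> D (x', y') = exp (2 * (k * \<tau> + h s)) *
       (((1 + \<alpha>\<^sup>2) * (\<rho> s)\<^sup>2 + (w s)\<^sup>2) * (x * x') + (\<rho> s * \<rho>' s + w s * w' s) * (x * y' + x' * y)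
        + ((\<rho>' s)\<^sup>2 + (w' s)\<^sup>2) * (y * y'))"
      using spiral_map_derivative[OF d\<rho>[OF s] dw[OF s]] unfolding \<sigma>_def by metis
    have "exp (2 * (k * \<tau> + h s)) = exp (2 * k * \<tau>) * exp (2 * h s)"
      by (simp add: exp_add[symmetric] algebra_simps)
    then have "D (\<eta>' s (x, y)) \<bullet> D (\<eta>' s (x', y')) =
      exp (2 * k * \<tau>) * (a s * (x * x') + b s * (x * y' + x' * y) + c s * (y * y'))" for x y x' y'
      unfolding eqa[OF s, symmetric] eqb[OF s, symmetric] eqc[OF s, symmetric]
      by (simp add: \<eta>'_def D(2)) (simp add: algebra_simps power2_eq_square)
    moreover have D\<sigma>: "D\<sigma> \<tau> s = D"
      using frechet_derivative_at[OF D(1)] by (simp add: D\<sigma>_def \<eta>_def)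
    ultimately show "(\<sigma> has_derivative D\<sigma> \<tau> s) (at (\<eta> (\<tau>, s)))"
      and "D\<sigma> \<tau> s (\<eta>' s (x, y)) \<bullet> D\<sigma> \<tau> s (\<eta>' s (x', y')) =
      exp (2 * k * \<tau>) * (a s * (x * x') + b s * (x * y' + x' * y) + c s * (y * y'))"
      using D(1) by (simp_all add: \<eta>_def)
  qed
  have "isCont h 0" using dh[of 0] \<delta> DERIV_isCont by auto
  moreover have "\<bar>k\<bar> * r / 2 > 0" using k r by simp
  ultimately obtain \<delta>1 where
    "\<delta>1 > 0" "\<forall>s. dist s 0 < \<delta>1 \<longrightarrow> dist (h s) (h 0) < \<bar>k\<bar> * r / 2"
    unfolding continuous_at_eps_delta by blast
  then have \<delta>1: "\<delta>1 > 0" "\<And>s. \<bar>s\<bar> < \<delta>1 \<Longrightarrow> \<bar>h s - h 0\<bar> < \<bar>k\<bar> * r / 2"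
    by (auto simp: dist_real_def)
  define \<delta>0 where "\<delta>0 = min \<delta> \<delta>1"
  define J0 where "J0 = {-\<delta>0<..<\<delta>0}"
  \<comment> \<open>Half of the available range \<open>\<bar>k\<bar> * r\<close> is left for
    \<theta> and half for the variation of \<open>h\<close> on \<open>J0\<close>, so that
    \<open>(\<theta> - h s) / k\<close> stays in \<open>{-r<..<r}\<close>.\<close>
  define \<Theta> where "\<Theta> = {h 0 - \<bar>k\<bar> * r / 2<..<h 0 + \<bar>k\<bar> * r / 2}"
  have J0J: "J0 \<subseteq> J" by (auto simp: J0_def J_def \<delta>0_def)
  have J00: "0 \<in> J0" using \<delta> \<delta>1 by (simp add: J0_def \<delta>0_def)
  have \<Theta>0: "h 0 \<in> \<Theta>" using k r by (simp add: \<Theta>_def)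
  have lift: "((\<theta> - h s) / k, s) \<in> B \<and> \<eta> ((\<theta> - h s) / k, s) = (\<theta>, s)"
    if "\<theta> \<in> \<Theta>" "s \<in> J0" for \<theta> s
  proof -
    have "\<bar>h s - h 0\<bar> < \<bar>k\<bar> * r / 2" using that \<delta>1(2)[of s] by (auto simp: J0_def \<delta>0_def abs_less_iff)
    moreover have "\<bar>\<theta> - h 0\<bar> < \<bar>k\<bar> * r / 2" 
      using that unfolding \<Theta>_def greaterThanLessThan_iff by linarith
    ultimately have "\<bar>\<theta> - h s\<bar> < \<bar>k\<bar> * r" by linarith
    then have "\<bar>(\<theta> - h s) / k\<bar> < r"
      using k by (simp add: abs_divide pos_divide_less_eq mult.commute)
    then have "(\<theta> - h s) / k \<in> {-r<..<r}" unfolding greaterThanLessThan_iff by linarith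
    moreover have "s \<in> {-r<..<r}" using that J0J J by (auto simp: J_def)
    ultimately show ?thesis using k by (simp add: B \<eta>_def)
  qed
  \<comment> \<open>The restriction has two stages: on \<open>V1\<close> the second coordinate lies
    in \<open>J\<close>, where \<open>h\<close> is smooth, so that the composition with \<eta> is
    continuous and the preimage \<open>V\<close> of the rectangle is open.\<close>
  define V1 where "V1 = V0 \<inter> \<Psi> -` (UNIV \<times> J)"
  have oV1: "open V1"
    unfolding V1_def using V0(2) oJ
    by (intro continuous_open_preimage smooth_on_imp_continuous_on \<Psi>(1) open_Times) auto
  have sm\<eta>\<Psi>: "smooth_on V1 (\<lambda>p. \<eta> (\<Psi> p))"
    by (rule smooth_on_compose[OF sm\<eta> oV1])
      (auto simp: V1_def intro: smooth_on_subset[OF \<Psi>(1)])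
  define V where "V = V1 \<inter> (\<lambda>p. \<eta> (\<Psi> p)) -` (\<Theta> \<times> J0)"
  have oV: "open V"
    unfolding V_def
    by (intro continuous_open_preimage smooth_on_imp_continuous_on sm\<eta>\<Psi> oV1 open_Times)
      (auto simp: \<Theta>_def J0_def)
  define f where "f = (\<lambda>p. \<sigma> (\<eta> (\<Psi> p)))"
  have sm\<sigma>: "smooth_on (\<Theta> \<times> J0) \<sigma>"
    unfolding \<sigma>_def
    by (rule smooth_on_spiral_map)
      (use J0J in \<open>auto simp: \<Theta>_def J0_def J_def intro: smooth_on_subset[OF sm\<rho>] smooth_on_subset[OF smw]\<close>)
  have smf: "smooth_on V f"
    unfolding f_def
    by (rule smooth_on_compose[OF sm\<sigma> oV]) (auto simp: V_def intro: smooth_on_subset[OF sm\<eta>\<Psi>])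
  have iso: "frechet_derivative f (at p) v \<bullet> frechet_derivative f (at p) u = metric_form E F G p v u"
    if p: "p \<in> V" for p v u
  proof -
    have pV0: "p \<in> V0" using p by (simp add: V_def V1_def)
    then obtain \<tau> s where x: "(\<tau>, s) \<in> B" "p = \<Phi> (\<tau>, s)" using V0 by auto
    have \<Psi>p: "\<Psi> p = (\<tau>, s)" using x \<Psi>(2) by simp
    have s: "s \<in> J" using p \<Psi>p by (auto simp: V_def V1_def)
    define \<Psi>' where "\<Psi>' = frechet_derivative \<Psi> (at p)"
    have \<Psi>': "(\<Psi> has_derivative \<Psi>') (at p)"
      unfolding \<Psi>'_def by (rule smooth_on_has_derivative[OF \<Psi>(1) pV0])
    \<comment> \<open>\<Phi> after \<Psi> is the identity on the open set \<open>V0\<close>, so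
      their derivatives are inverse to each other there, and the metric in adapted coordinates turns
      back into \<open>metric_form\<close> at \<open>p\<close>.\<close>
    have "((\<lambda>q. \<Phi> (\<Psi> q)) has_derivative (\<lambda>v. \<Phi>' (\<tau>, s) (\<Psi>' v))) (at p)"
      by (rule has_derivative_compose[where f=\<Psi> and g=\<Phi>, OF \<Psi>']) (use \<Phi>[OF x(1)] \<Psi>p in simp)
    then have "((\<lambda>q. q) has_derivative (\<lambda>v. \<Phi>' (\<tau>, s) (\<Psi>' v))) (at p)"
      by (rule has_derivative_transform_within_open[OF _ V0(2) pV0]) (use V0(1) \<Psi>(2) in auto)
    from fun_cong[OF has_derivative_unique[OF has_derivative_ident this]]
    have inv: "\<Phi>' (\<tau>, s) (\<Psi>' v) = v" for v by simp
    have "((\<lambda>q. \<eta> (\<Psi> q)) has_derivative (\<lambda>v. \<eta>' s (\<Psi>' v))) (at p)"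
      by (rule has_derivative_compose[where f=\<Psi> and g=\<eta>, OF \<Psi>']) (use d\<eta>[OF s] \<Psi>p in simp)
    then have "(f has_derivative (\<lambda>v. D\<sigma> \<tau> s (\<eta>' s (\<Psi>' v)))) (at p)"
      unfolding f_def
      by (rule has_derivative_compose[where f="\<lambda>q. \<eta> (\<Psi> q)" and g=\<sigma>]) (use D\<sigma>[OF s] \<Psi>p in simp)
    then have fd: "frechet_derivative f (at p) = (\<lambda>v. D\<sigma> \<tau> s (\<eta>' s (\<Psi>' v)))"
      by (rule frechet_derivative_at[symmetric])
    have "D\<sigma> \<tau> s (\<eta>' s (\<Psi>' v)) \<bullet> D\<sigma> \<tau> s (\<eta>' s (\<Psi>' u))
      = metric_form E F G (\<Phi> (\<tau>, s)) (\<Phi>' (\<tau>, s) (\<Psi>' v)) (\<Phi>' (\<tau>, s) (\<Psi>' u))"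
      using inner[OF s, of \<tau> "fst (\<Psi>' v)" "snd (\<Psi>' v)" "fst (\<Psi>' u)" "snd (\<Psi>' u)"]
        g[OF x(1), of "fst (\<Psi>' v)" "snd (\<Psi>' v)" "fst (\<Psi>' u)" "snd (\<Psi>' u)"] by simp
    then show ?thesis unfolding inv fd x(2)[symmetric] .
  qed
  have iso_f: "isometric_immersion_on V E F G f"
    unfolding isometric_immersion_on_def partial_u_def partial_v_def
    using smf by (simp add: iso) (simp add: metric_form_def)
  have "immersion_on (\<Theta> \<times> J0) \<sigma>"
    unfolding immersion_on_def
  proof (intro conjI sm\<sigma> ballI)
    fix p assume "p \<in> \<Theta> \<times> J0"
    then obtain \<theta> s where p: "p = (\<theta>, s)" "\<theta> \<in> \<Theta>" "s \<in> J0" by auto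
    define \<tau> where "\<tau> = (\<theta> - h s) / k"
    have \<eta>p: "\<eta> (\<tau>, s) = p" and sJ: "s \<in> J" using lift[OF p(2,3)] p J0J by (auto simp: \<tau>_def)
    then have fd: "frechet_derivative \<sigma> (at p) = D\<sigma> \<tau> s"
      by (simp add: D\<sigma>_def)
    have lin: "linear (D\<sigma> \<tau> s)" using D\<sigma>[OF sJ] has_derivative_linear by blast
    have "v = 0" if v: "D\<sigma> \<tau> s v = 0" for v
    proof -
      \<comment> \<open>Inverts the linear shear \<open>\<eta>' s\<close>. A kernel vector of the
        derivative thus becomes a null vector of the definite form with coefficients
        \<open>a s\<close>, \<open>b s\<close>, \<open>c s\<close>.\<close>
      define x where "x = (fst v - h' s * snd v) / k"
      have v\<eta>: "v = \<eta>' s (x, snd v)" using k by (simp add: \<eta>'_def x_def prod_eq_iff)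
      have "D\<sigma> \<tau> s (\<eta>' s (x, snd v)) \<bullet> D\<sigma> \<tau> s (\<eta>' s (x, snd v)) = 0"
        using v v\<eta> by simp
      then have "a s * (x * x) + b s * (x * snd v + x * snd v) + c s * (snd v * snd v) = 0"
        unfolding inner[OF sJ] by simp
      moreover have "s \<in> {-r<..<r}" using sJ J by (auto simp: J_def)
      ultimately have "x = 0 \<and> snd v = 0" using binary_form_zero pos by blast
      then show "v = 0" using v\<eta> by (simp add: \<eta>'_def zero_prod_def)
    qed
    then show "inj (frechet_derivative \<sigma> (at p))"
      unfolding fd using linear_injective_0[OF lin] by blast
  qed
  moreover have "f ` V = \<sigma> ` (\<Theta> \<times> J0)"
  proof
    show "\<sigma> ` (\<Theta> \<times> J0) \<subseteq> f ` V"
    proof clarify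
      fix \<theta> s assume *: "\<theta> \<in> \<Theta>" "s \<in> J0"
      define x where "x = ((\<theta> - h s) / k, s)"
      have x: "x \<in> B" "\<eta> x = (\<theta>, s)" using lift[OF *] by (auto simp: x_def)
      have "\<Phi> x \<in> V" using x * J0J V0 \<Psi>(2) by (auto simp: V_def V1_def x_def)
      moreover have "f (\<Phi> x) = \<sigma> (\<theta>, s)" using x \<Psi>(2) by (simp add: f_def)
      ultimately show "\<sigma> (\<theta>, s) \<in> f ` V" by (metis imageI)
    qed
  qed (auto simp: f_def V_def)
  moreover have "smooth_on J0 \<rho>" "smooth_on J0 w"
    using smooth_on_subset[OF sm\<rho>] smooth_on_subset[OF smw] J0J by (simp_all add: J_def)
  moreover have "open \<Theta>" "connected \<Theta>" "open J0" "connected J0" "\<Theta> \<noteq> {}" "J0 \<noteq> {}"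
    using \<Theta>0 J00 by (auto simp: \<Theta>_def J0_def)
  \<comment> \<open>The spiral is built about the z-axis with centre at the origin, so the rigid
    motion is the identity.\<close>
  ultimately have "orthogonal_transformation id \<and> \<alpha> \<noteq> 0 \<and>
      open \<Theta> \<and> connected \<Theta> \<and> \<Theta> \<noteq> {} \<and> open J0 \<and> connected J0 \<and> J0 \<noteq> {} \<and>
      smooth_on J0 \<rho> \<and> smooth_on J0 w \<and> immersion_on (\<Theta> \<times> J0) (spiral_map \<alpha> \<rho> w) \<and>
      f ` V = (\<lambda>x. 0 + id x) ` spiral_map \<alpha> \<rho> w ` (\<Theta> \<times> J0)"
    using \<alpha> orthogonal_transformation_id by (simp add: \<sigma>_def id_def)
  then have "lie_spiral_surface (f ` V)"
    unfolding lie_spiral_surface_def by (intro exI)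
  moreover have "\<Phi> (0, 0) \<in> V"
  proof -
    have "(0, 0) \<in> B" using r by (simp add: B)
    then show ?thesis using V0 \<Psi>(2)[of "(0, 0)"] J00 J0J \<Theta>0
      by (auto simp: V_def V1_def \<eta>_def)
  qed
  moreover have "V \<subseteq> V0" by (auto simp: V_def V1_def)
  ultimately show ?thesis using oV iso_f by blast
qed

section \<open>Metrics scaled by a flow\<close>

text \<open>Along an integral curve \<open>f\<close> satisfies \<open>y' = l * y\<close>; the
  product with \<open>exp (- l * t)\<close> has derivative 0 and is constant.\<close>

lemma scaling_along_flow:
  fixes f :: "real \<times> real \<Rightarrow> real"
  assumes "open U" "smooth_on U f" "r > 0"
    and \<gamma>: "\<And>\<tau>. \<tau> \<in> {-r<..<r} \<Longrightarrow> \<gamma> \<tau> \<in> U"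
      "\<And>\<tau>. \<tau> \<in> {-r<..<r} \<Longrightarrow> (\<gamma> has_vector_derivative X (\<gamma> \<tau>)) (at \<tau>)"
    and inv: "\<And>p. p \<in> U \<Longrightarrow> frechet_derivative f (at p) (X p) = l * f p"
    and \<tau>: "\<tau> \<in> {-r<..<r}"
  shows "f (\<gamma> \<tau>) = exp (l * \<tau>) * f (\<gamma> 0)"
proof -
  have "((\<lambda>t. exp (- l * t) * f (\<gamma> t)) has_field_derivative 0) (at t within {-r<..<r})"
    if t: "t \<in> {-r<..<r}" for t
  proof -
    have "((\<lambda>t. f (\<gamma> t)) has_vector_derivative frechet_derivative f (at (\<gamma> t)) (X (\<gamma> t))) (at t)"
      using vector_derivative_diff_chain_within[OF \<gamma>(2)[OF t]
          has_derivative_at_withinI[OF smooth_on_has_derivative[OF assms(2) \<gamma>(1)[OF t]]]]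
      by (simp add: o_def)
    then have "((\<lambda>t. f (\<gamma> t)) has_real_derivative l * f (\<gamma> t)) (at t)"
      using inv[OF \<gamma>(1)[OF t]] by (simp add: has_real_derivative_iff_has_vector_derivative)
    then have "((\<lambda>t. exp (- l * t) * f (\<gamma> t)) has_real_derivative 0) (at t)"
      by (auto intro!: derivative_eq_intros)
    then show ?thesis by (rule has_field_derivative_at_within)
  qed
  then have "\<exists>c. \<forall>t\<in>{-r<..<r}. exp (- l * t) * f (\<gamma> t) = c"
    by (intro has_field_derivative_zero_constant convex_real_interval) simp
  then obtain c where c: "\<forall>t\<in>{-r<..<r}. exp (- l * t) * f (\<gamma> t) = c" ..
  have "exp (- l * \<tau>) * f (\<gamma> \<tau>) = exp (- l * 0) * f (\<gamma> 0)"
    using bspec[OF c \<tau>] bspec[OF c, of 0] assms(3) by simp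
  then show ?thesis by (simp add: exp_minus field_simps)
qed

definition positive_metric ::
  "(real \<times> real) set \<Rightarrow> (real \<times> real \<Rightarrow> real) \<Rightarrow> (real \<times> real \<Rightarrow> real) \<Rightarrow> (real \<times> real \<Rightarrow> real) \<Rightarrow> bool"
where
  "positive_metric U E F G \<longleftrightarrow> smooth_on U E \<and> smooth_on U F \<and> smooth_on U G \<and>
     (\<forall>p\<in>U. E p > 0 \<and> E p * G p - (F p)\<^sup>2 > 0)"

text \<open>A condition on a single coefficient as a scalar function, not a Lie derivative of the
  metric. The effect of the flow on tangent vectors is recorded separately, by the exponent
  \<open>m\<close> below.\<close>

definition scales_along ::
  "(real \<times> real) set \<Rightarrow> (real \<times> real \<Rightarrow> real \<times> real) \<Rightarrow> real \<Rightarrow> (real \<times> real \<Rightarrow> real) \<Rightarrow> bool"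
where "scales_along U X l f \<longleftrightarrow> (\<forall>p\<in>U. frechet_derivative f (at p) (X p) = l * f p)"

lemma metric_form_add:
  "metric_form E F G p (v + v') w = metric_form E F G p v w + metric_form E F G p v' w"
  "metric_form E F G p v (w + w') = metric_form E F G p v w + metric_form E F G p v w'"
  by (simp_all add: metric_form_def algebra_simps)

lemma metric_form_scaleR:
  "metric_form E F G p (x *\<^sub>R v) w = x * metric_form E F G p v w"
  "metric_form E F G p v (x *\<^sub>R w) = x * metric_form E F G p v w"
  by (simp_all add: metric_form_def algebra_simps)

lemma metric_form_commute: "metric_form E F G p v w = metric_form E F G p w v"
  by (simp add: metric_form_def mult.commute)

lemma metric_form_bilinear:
  "metric_form E F G p (x *\<^sub>R P + y *\<^sub>R Q) (x' *\<^sub>R P + y' *\<^sub>R Q) =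
   metric_form E F G p P P * (x * x') + metric_form E F G p P Q * (x * y' + x' * y)
     + metric_form E F G p Q Q * (y * y')"
  unfolding metric_form_add metric_form_scaleR metric_form_commute[of E F G p Q P]
  by (simp add: distrib_left distrib_right mult_ac)

text \<open>The coefficients scale by \<open>exp (l * \<tau>)\<close> and each of the two tangent
  vectors by \<open>exp (m * \<tau>)\<close>, so the metric scales by
  \<open>exp ((l + 2 * m) * \<tau>)\<close>. The Gram matrix of the frame \<open>P\<close>,
  \<open>Q\<close> along \<tau> = 0 supplies \<open>a\<close>, \<open>b\<close>,
  \<open>c\<close>.\<close>

lemma flow_invariant_metric_spiral_immersion:
  fixes \<Phi> \<Psi> X :: "real \<times> real \<Rightarrow> real \<times> real" and P Q :: "real \<Rightarrow> real \<times> real"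
  assumes U: "open U" and metric: "positive_metric U E F G"
    and inv: "scales_along U X l E" "scales_along U X l F" "scales_along U X l G"
    and lm: "l + 2 * m \<noteq> 0"
    and r: "r > 0" and B: "B = {-r<..<r} \<times> {-r<..<r}" and \<Phi>U: "\<Phi> ` B \<subseteq> U"
    and \<Phi>: "smooth_on B \<Phi>"
    and \<Phi>': "\<And>\<tau> s. (\<tau>, s) \<in> B \<Longrightarrow>
      (\<Phi> has_derivative (\<lambda>v. exp (m * \<tau>) *\<^sub>R (fst v *\<^sub>R P s + snd v *\<^sub>R Q s))) (at (\<tau>, s))"
    and flow: "\<And>\<tau> s. (\<tau>, s) \<in> B \<Longrightarrow> exp (m * \<tau>) *\<^sub>R P s = X (\<Phi> (\<tau>, s))"
    and PQ: "smooth_on {-r<..<r} P" "smooth_on {-r<..<r} Q"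
      "\<And>s. s \<in> {-r<..<r} \<Longrightarrow> fst (P s) * snd (Q s) - snd (P s) * fst (Q s) \<noteq> 0"
    and \<Psi>: "open (\<Phi> ` B)" "smooth_on (\<Phi> ` B) \<Psi>" "\<And>x. x \<in> B \<Longrightarrow> \<Psi> (\<Phi> x) = x"
  shows "\<exists>V f. open V \<and> \<Phi> (0, 0) \<in> V \<and> V \<subseteq> U \<and>
    isometric_immersion_on V E F G f \<and> lie_spiral_surface (f ` V)"
proof -
  define I where "I = {-r<..<r}"
  have oI: "open I" by (simp add: I_def)
  have sm: "smooth_on U E" "smooth_on U F" "smooth_on U G"
    using metric by (auto simp: positive_metric_def)
  define k where "k = (l + 2 * m) / 2"
  have k: "k \<noteq> 0" using lm by (simp add: k_def)
  have axis: "smooth_on I (\<lambda>s. f (\<Phi> (0, s)))" if "smooth_on U f" for f :: "real \<times> real \<Rightarrow> real"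
  proof (rule smooth_on_compose[OF that oI])
    show "smooth_on I (\<lambda>s. \<Phi> (0, s))"
      by (rule smooth_on_compose[OF \<Phi> oI]) (use r in \<open>auto simp: B I_def intro!: smooth_on_intros\<close>)
    show "\<Phi> (0, s) \<in> U" if "s \<in> I" for s
      using that r \<Phi>U by (auto simp: B I_def)
  qed
  define g where "g = (\<lambda>P Q s. metric_form E F G (\<Phi> (0, s)) (P s) (Q s))"
  have smg: "smooth_on I (g P Q)" if "smooth_on I P" "smooth_on I Q" for P Q
    unfolding g_def metric_form_def by (intro smooth_on_intros oI axis sm that)
  have \<Phi>0: "\<Phi> (0, s) \<in> U" if "s \<in> I" for s using that r \<Phi>U by (auto simp: B I_def)
  have scale: "f (\<Phi> (\<tau>, s)) = exp (l * \<tau>) * f (\<Phi> (0, s))"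
    if "smooth_on U f" "scales_along U X l f" "(\<tau>, s) \<in> B" for f \<tau> s
  proof (rule scaling_along_flow[OF U that(1) r, where \<gamma>="\<lambda>t. \<Phi> (t, s)" and X=X])
    show "\<Phi> (t, s) \<in> U" if "t \<in> {-r<..<r}" for t
      using that \<open>(\<tau>, s) \<in> B\<close> \<Phi>U by (auto simp: B)
    show "((\<lambda>t. \<Phi> (t, s)) has_vector_derivative X (\<Phi> (t, s))) (at t)" if "t \<in> {-r<..<r}" for t
    proof -
      have ts: "(t, s) \<in> B" using that \<open>(\<tau>, s) \<in> B\<close> by (auto simp: B)
      have "((\<lambda>t. \<Phi> (t, s)) has_derivative
          (\<lambda>x. exp (m * t) *\<^sub>R (fst (x, 0::real) *\<^sub>R P s + snd (x, 0::real) *\<^sub>R Q s))) (at t)"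
        by (rule has_derivative_compose[where f="\<lambda>t. (t, s)" and g=\<Phi>])
          (use \<Phi>'[OF ts] in \<open>auto intro!: derivative_eq_intros\<close>)
      then show ?thesis
        unfolding has_vector_derivative_def flow[OF ts, symmetric] by (simp add: mult.commute)
    qed
    show "frechet_derivative f (at p) (X p) = l * f p" if "p \<in> U" for p
      using that \<open>scales_along U X l f\<close> by (simp add: scales_along_def)
    show "\<tau> \<in> {-r<..<r}" using \<open>(\<tau>, s) \<in> B\<close> by (simp add: B)
  qed
  have pos: "g P P s > 0 \<and> g P P s * g Q Q s - (g P Q s)\<^sup>2 > 0" if s: "s \<in> I" for s
  proof -
    let ?p = "\<Phi> (0, s)" and ?c = "fst (P s) * snd (Q s) - snd (P s) * fst (Q s)"
    have E: "E ?p > 0" "E ?p * G ?p - (F ?p)\<^sup>2 > 0"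
      using metric \<Phi>0[OF s] by (auto simp: positive_metric_def)
    have c: "?c \<noteq> 0" using PQ(3) s by (simp add: I_def)
    \<comment> \<open>The Gram determinant is that of the metric times the squared determinant of
      the frame.\<close>
    have "g P P s * g Q Q s - (g P Q s)\<^sup>2 = (E ?p * G ?p - (F ?p)\<^sup>2) * ?c\<^sup>2"
      by (simp add: g_def metric_form_def power2_eq_square algebra_simps)
    then have 1: "g P P s * g Q Q s - (g P Q s)\<^sup>2 > 0" using E c by simp
    \<comment> \<open>Completing the square. If the second component of \<open>P s\<close> vanishes,
      the nonzero frame determinant prevents the first from vanishing as well.\<close>
    have 2: "E ?p * g P P s = (E ?p * fst (P s) + F ?p * snd (P s))\<^sup>2
        + (E ?p * G ?p - (F ?p)\<^sup>2) * (snd (P s))\<^sup>2"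
      by (simp add: g_def metric_form_def power2_eq_square algebra_simps)
    have "E ?p * g P P s > 0"
    proof (cases "snd (P s) = 0")
      case True
      then show ?thesis unfolding 2 using c E by auto
    next
      case False
      then show ?thesis unfolding 2 using E by (intro add_nonneg_pos) auto
    qed
    then show ?thesis using 1 E by (simp add: zero_less_mult_iff)
  qed
  let ?\<Phi>' = "\<lambda>x v. exp (m * fst x) *\<^sub>R (fst v *\<^sub>R P (snd x) + snd v *\<^sub>R Q (snd x))"
  have "\<exists>V f. open V \<and> \<Phi> (0, 0) \<in> V \<and> V \<subseteq> \<Phi> ` B \<and>
    isometric_immersion_on V E F G f \<and> lie_spiral_surface (f ` V)"
  proof (rule homothetic_metric_spiral_immersion[OF k r B _ refl \<Psi>, where \<Phi>'="?\<Phi>'"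
        and a="g P P" and b="g P Q" and c="g Q Q"])
    fix \<tau> s x y x' y' assume ts: "(\<tau>, s) \<in> B"
    have e: "exp (2 * k * \<tau>) = exp (l * \<tau>) * (exp (m * \<tau>) * exp (m * \<tau>))"
      by (simp add: k_def algebra_simps flip: exp_add)
    let ?b = "g P P s * (x * x') + g P Q s * (x * y' + x' * y) + g Q Q s * (y * y')"
    have "metric_form E F G (\<Phi> (\<tau>, s)) v w = exp (l * \<tau>) * metric_form E F G (\<Phi> (0, s)) v w" for v w
      unfolding metric_form_def scale[OF sm(1) inv(1) ts] scale[OF sm(2) inv(2) ts] scale[OF sm(3) inv(3) ts]
      by (simp only: distrib_left mult.assoc)
    moreover have "metric_form E F G (\<Phi> (0, s)) (?\<Phi>' (\<tau>, s) (x, y)) (?\<Phi>' (\<tau>, s) (x', y'))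
      = exp (m * \<tau>) * (exp (m * \<tau>) * ?b)"
      by (simp only: fst_conv snd_conv metric_form_scaleR(1)[of E F G _ "exp _"]
          metric_form_scaleR(2)[of E F G _ _ "exp _"] metric_form_bilinear g_def)
    ultimately have "metric_form E F G (\<Phi> (\<tau>, s)) (?\<Phi>' (\<tau>, s) (x, y)) (?\<Phi>' (\<tau>, s) (x', y'))
      = exp (l * \<tau>) * (exp (m * \<tau>) * (exp (m * \<tau>) * ?b))" by (simp only:)
    then show "metric_form E F G (\<Phi> (\<tau>, s)) (?\<Phi>' (\<tau>, s) (x, y)) (?\<Phi>' (\<tau>, s) (x', y'))
      = exp (2 * k * \<tau>) * ?b"
      unfolding e by (simp only: mult.assoc)
  next
    show "(\<Phi> has_derivative ?\<Phi>' x) (at x)" if "x \<in> B" for x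
      using \<Phi>'[of "fst x" "snd x"] that by simp
  next
    show "smooth_on {-r<..<r} (g P P)" "smooth_on {-r<..<r} (g P Q)" "smooth_on {-r<..<r} (g Q Q)"
      using smg[OF PQ(1,2)[folded I_def]] smg[OF PQ(1,1)[folded I_def]] smg[OF PQ(2,2)[folded I_def]]
      by (simp_all only: I_def)
    show "g P P s > 0" "g P P s * g Q Q s - (g P Q s)\<^sup>2 > 0" if "s \<in> {-r<..<r}" for s
      using pos[OF that[folded I_def]] by (rule conjunct1, rule conjunct2)
  qed assumption+
  then obtain V f where "open V" "\<Phi> (0, 0) \<in> V" "V \<subseteq> \<Phi> ` B"
    "isometric_immersion_on V E F G f" "lie_spiral_surface (f ` V)"
    by (elim exE conjE)
  moreover from this(3) have "V \<subseteq> U" using \<Phi>U by (rule order_trans)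
  ultimately show ?thesis by (intro exI conjI)
qed

text \<open>A shear straightens the constant field: \<tau> runs along \<open>(1, \<kappa>)\<close>
  and \<open>s\<close> along the second axis. The flow does not change tangent vectors, hence
  \<open>m = 0\<close>.\<close>

lemma translation_invariant_metric_spiral_immersion:
  fixes \<kappa> :: real
  assumes U: "open U" and metric: "positive_metric U E F G"
    and inv: "scales_along U (\<lambda>p. (1, \<kappa>)) l E" "scales_along U (\<lambda>p. (1, \<kappa>)) l F"
      "scales_along U (\<lambda>p. (1, \<kappa>)) l G"
    and l: "l \<noteq> 0" and p0: "p0 \<in> U"
  shows "\<exists>V f. open V \<and> p0 \<in> V \<and> V \<subseteq> U \<and>
    isometric_immersion_on V E F G f \<and> lie_spiral_surface (f ` V)"
proof -
  define \<Phi> where "\<Phi> = (\<lambda>x. p0 + (fst x, \<kappa> * fst x + snd x))"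
  define \<Psi> where "\<Psi> = (\<lambda>p. (fst (p - p0), snd (p - p0) - \<kappa> * fst (p - p0)))"
  have sm: "smooth_on S \<Phi>" "smooth_on S \<Psi>" if "open S" for S
    unfolding \<Phi>_def \<Psi>_def by (intro smooth_on_intros that)+
  have \<Psi>\<Phi>: "\<Psi> (\<Phi> x) = x" "\<Phi> (\<Psi> x) = x" for x by (simp_all add: \<Phi>_def \<Psi>_def prod_eq_iff)
  have \<Phi>0: "\<Phi> (0, 0) = p0" by (simp add: \<Phi>_def zero_prod_def[symmetric])
  have vimage_open: "open (h -` S)"
    if "smooth_on UNIV h" "open S" for h :: "real \<times> real \<Rightarrow> real \<times> real" and S
    using continuous_open_preimage[OF smooth_on_imp_continuous_on[OF that(1)] open_UNIV that(2)] by simp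
  obtain r where r: "r > 0" "{-r..r} \<times> {-r..r} \<subseteq> \<Phi> -` U"
    using open_contains_square[OF vimage_open[OF sm(1) U]] p0 \<Phi>0 by auto
  define B where "B = {-r<..<r} \<times> {-r<..<r}"
  have oB: "open B" by (simp add: B_def open_Times)
  have "\<Phi> ` B = \<Psi> -` B"
  proof
    show "\<Phi> ` B \<subseteq> \<Psi> -` B" using \<Psi>\<Phi>(1) by auto
    show "\<Psi> -` B \<subseteq> \<Phi> ` B" using \<Psi>\<Phi>(2) by (metis image_eqI subsetI vimageD)
  qed
  then have o: "open (\<Phi> ` B)" using vimage_open[OF sm(2) oB] by simp
  have "B \<subseteq> {-r..r} \<times> {-r..r}" by (auto simp: B_def)
  then have "B \<subseteq> \<Phi> -` U" using r(2) by (rule order_trans)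
  have "\<exists>V f. open V \<and> \<Phi> (0, 0) \<in> V \<and> V \<subseteq> U \<and>
    isometric_immersion_on V E F G f \<and> lie_spiral_surface (f ` V)"
  proof (rule flow_invariant_metric_spiral_immersion[OF U metric inv _ r(1) B_def, where m=0
        and P="\<lambda>s. (1, \<kappa>)" and Q="\<lambda>s. (0, 1)" and \<Psi>=\<Psi>])
    show "\<Phi> ` B \<subseteq> U" using \<open>B \<subseteq> \<Phi> -` U\<close> by blast
    fix \<tau> s
    show "(\<Phi> has_derivative (\<lambda>v. exp (0 * \<tau>) *\<^sub>R (fst v *\<^sub>R (1, \<kappa>) + snd v *\<^sub>R (0, 1)))) (at (\<tau>, s))"
      unfolding \<Phi>_def
      by (rule derivative_eq_intros refl)+ (simp add: fun_eq_iff prod_eq_iff)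
  next
    show "smooth_on (\<Phi> ` B) \<Psi>" by (rule sm(2)[OF o])
  qed (simp_all add: l \<Psi>\<Phi>(1) sm(1)[OF oB] o)
  then show ?thesis unfolding \<Phi>0 .
qed

text \<open>The line through \<open>p0\<close> perpendicular to \<open>p0 - q\<close>, with
  parameter \<open>s\<close>, is moved along the rays from \<open>q\<close> by the factor
  \<open>exp \<tau>\<close>; these coordinates cover an open half-plane. The flow scales tangent
  vectors by the same factor, hence \<open>m = 1\<close>, and \<open>l \<noteq> -2\<close> is what
  makes the homothety rate nonzero.\<close>

lemma dilation_invariant_metric_spiral_immersion:
  fixes q p0 :: "real \<times> real"
  assumes U: "open U" and metric: "positive_metric U E F G"
    and inv: "scales_along U (\<lambda>p. p - q) l E" "scales_along U (\<lambda>p. p - q) l F"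
      "scales_along U (\<lambda>p. p - q) l G"
    and l: "l \<noteq> -2" and p0: "p0 \<in> U" "p0 \<noteq> q"
  shows "\<exists>V f. open V \<and> p0 \<in> V \<and> V \<subseteq> U \<and>
    isometric_immersion_on V E F G f \<and> lie_spiral_surface (f ` V)"
proof -
  define c where "c = fst (p0 - q)"
  define d where "d = snd (p0 - q)"
  define N where "N = c\<^sup>2 + d\<^sup>2"
  have "c \<noteq> 0 \<or> d \<noteq> 0" using p0(2) by (auto simp: c_def d_def prod_eq_iff)
  then have N: "N > 0" by (auto simp: N_def sum_power2_gt_zero_iff)
  define P where "P = (\<lambda>s. (c - s * d, d + s * c))"
  define \<Phi> where "\<Phi> = (\<lambda>x. q + exp (fst x) *\<^sub>R P (snd x))"
  define H where "H = {p. c * fst (p - q) + d * snd (p - q) > 0}"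
  \<comment> \<open>Dot and cross product with \<open>(c, d)\<close> recover the coordinates: at
    \<open>\<Phi> x\<close> they are \<open>exp (fst x) * N\<close> and \<open>snd x\<close> times
    that.\<close>
  define \<Psi> where "\<Psi> = (\<lambda>p. (ln ((c * fst (p - q) + d * snd (p - q)) / N),
    (c * snd (p - q) - d * fst (p - q)) / (c * fst (p - q) + d * snd (p - q))))"
  have oH: "open H" unfolding H_def by (intro open_Collect_less continuous_intros)
  have sm\<Phi>: "smooth_on S \<Phi>" if "open S" for S
    unfolding \<Phi>_def P_def by (intro smooth_on_intros that)
  have sm\<Psi>: "smooth_on H \<Psi>"
    unfolding \<Psi>_def using N by (intro smooth_on_intros oH) (auto simp: H_def)
  have dot: "c * fst (\<Phi> x - q) + d * snd (\<Phi> x - q) = exp (fst x) * N"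
    and cross: "c * snd (\<Phi> x - q) - d * fst (\<Phi> x - q) = snd x * (exp (fst x) * N)" for x
    by (simp_all add: \<Phi>_def P_def N_def power2_eq_square algebra_simps)
  have \<Psi>\<Phi>: "\<Psi> (\<Phi> x) = x" for x
    unfolding \<Psi>_def dot cross using N by simp
  have \<Phi>H: "\<Phi> x \<in> H" for x
    unfolding H_def mem_Collect_eq dot using N by simp
  have \<Phi>\<Psi>: "\<Phi> (\<Psi> p) = p" if "p \<in> H" for p
  proof -
    define u where "u = fst (p - q)"
    define v where "v = snd (p - q)"
    define D where "D = c * u + d * v"
    have D: "D > 0" using that by (simp add: H_def D_def u_def v_def)
    have "\<Psi> p = (ln (D / N), (c * v - d * u) / D)" by (simp add: \<Psi>_def D_def u_def v_def)
    then have "\<Phi> (\<Psi> p) - q = (D / N) *\<^sub>R P ((c * v - d * u) / D)"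
      using D N by (simp add: \<Phi>_def)
    also have "\<dots> = (u, v)"
    proof -
      have "D * c - (c * v - d * u) * d = u * N" "D * d + (c * v - d * u) * c = v * N"
        by (simp_all add: D_def N_def power2_eq_square algebra_simps)
      then show ?thesis using D N by (simp add: P_def field_simps)
    qed
    also have "\<dots> = p - q" by (simp add: u_def v_def prod_eq_iff)
    finally show ?thesis by simp
  qed
  have \<Phi>0: "\<Phi> (0, 0) = p0" by (simp add: \<Phi>_def P_def c_def d_def prod_eq_iff)
  have "open (\<Phi> -` U)"
    using continuous_open_preimage[OF smooth_on_imp_continuous_on[OF sm\<Phi>[OF open_UNIV]] open_UNIV U] by simp
  then obtain r where r: "r > 0" "{-r..r} \<times> {-r..r} \<subseteq> \<Phi> -` U"
    using open_contains_square p0 \<Phi>0 by (metis vimageI)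
  define B where "B = {-r<..<r} \<times> {-r<..<r}"
  have oB: "open B" by (simp add: B_def open_Times)
  have \<Phi>B: "\<Phi> ` B = H \<inter> \<Psi> -` B"
  proof
    show "\<Phi> ` B \<subseteq> H \<inter> \<Psi> -` B" using \<Psi>\<Phi> \<Phi>H by auto
    show "H \<inter> \<Psi> -` B \<subseteq> \<Phi> ` B" using \<Phi>\<Psi> by (metis IntE image_eqI subsetI vimageD)
  qed
  have o: "open (\<Phi> ` B)"
    unfolding \<Phi>B by (intro continuous_open_preimage smooth_on_imp_continuous_on sm\<Psi> oH oB)
  have "B \<subseteq> {-r..r} \<times> {-r..r}" by (auto simp: B_def)
  then have "B \<subseteq> \<Phi> -` U" using r(2) by (rule order_trans)
  have "\<exists>V f. open V \<and> \<Phi> (0, 0) \<in> V \<and> V \<subseteq> U \<and>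
    isometric_immersion_on V E F G f \<and> lie_spiral_surface (f ` V)"
  proof (rule flow_invariant_metric_spiral_immersion[OF U metric inv _ r(1) B_def, where m=1
        and P=P and Q="\<lambda>s. (- d, c)" and \<Psi>=\<Psi>])
    show "\<Phi> ` B \<subseteq> U" using \<open>B \<subseteq> \<Phi> -` U\<close> by blast
    fix \<tau> s
    show "(\<Phi> has_derivative (\<lambda>v. exp (1 * \<tau>) *\<^sub>R (fst v *\<^sub>R P s + snd v *\<^sub>R (- d, c)))) (at (\<tau>, s))"
      unfolding \<Phi>_def P_def
      by (rule derivative_eq_intros refl)+ (simp add: fun_eq_iff prod_eq_iff algebra_simps)
  next
    fix s
    have "fst (P s) * snd (- d, c) - snd (P s) * fst (- d, c) = N"
      by (simp add: P_def N_def power2_eq_square algebra_simps)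
    then show "fst (P s) * snd (- d, c) - snd (P s) * fst (- d, c) \<noteq> 0" using N by simp
  next
    show "smooth_on (\<Phi> ` B) \<Psi>" unfolding \<Phi>B by (rule smooth_on_subset[OF sm\<Psi>]) simp
    show "smooth_on {-r<..<r} P" unfolding P_def by (intro smooth_on_intros) simp_all
  next
    show "exp (1 * \<tau>) *\<^sub>R P s = \<Phi> (\<tau>, s) - q" for \<tau> s by (simp add: \<Phi>_def)
    show "l + 2 * 1 \<noteq> 0" using l by linarith
  qed (simp_all add: \<Psi>\<Phi> sm\<Phi>[OF oB] o)
  then show ?thesis unfolding \<Phi>0 .
qed

text \<open>Homogeneity of degree 0 makes \<open>f\<close> constant on each segment from the origin,
  and continuity at the origin, which lies in the domain, gives all segments the same value. The
  derivative then vanishes on the ball, whatever the field \<open>X\<close>.\<close>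

lemma scales_along_zero_constant:
  fixes f :: "real \<times> real \<Rightarrow> real"
  assumes f: "smooth_on U f" and inv: "scales_along U (\<lambda>p. p) 0 f" and e: "ball 0 e \<subseteq> U"
  shows "scales_along (ball 0 e) X 0 f"
proof -
  have der: "(f has_derivative frechet_derivative f (at p)) (at p)" if "p \<in> ball 0 e" for p
    using smooth_on_has_derivative[OF f, of p] e that by blast
  have const: "f p = f 0" if p: "p \<in> ball 0 e" for p
  proof -
    have tp: "t *\<^sub>R p \<in> ball 0 e" if "t \<in> {0..1}" for t
      using p that mult_left_le_one_le[of "norm p" "\<bar>t\<bar>"] by auto
    have deriv: "((\<lambda>t. f (t *\<^sub>R p)) has_derivative (\<lambda>h. frechet_derivative f (at (t *\<^sub>R p)) (h *\<^sub>R p))) (at t)"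
      if "t \<in> {0..1}" for t
      by (rule has_derivative_compose[where f="\<lambda>t. t *\<^sub>R p" and g=f])
        (use der[OF tp[OF that]] in \<open>auto intro!: derivative_eq_intros\<close>)
    have "f (1 *\<^sub>R p) = f (0 *\<^sub>R p)"
    proof (rule DERIV_isconst_end[where f="\<lambda>t. f (t *\<^sub>R p)" and a=0 and b=1])
      show "continuous_on {0..1} (\<lambda>t. f (t *\<^sub>R p))"
        using deriv has_derivative_continuous by (blast intro: continuous_at_imp_continuous_on)
      fix t :: real assume t: "0 < t" "t < 1"
      let ?D = "frechet_derivative f (at (t *\<^sub>R p))"
      have lin: "linear ?D" using has_derivative_linear[OF der[OF tp[of t]]] t by simp
      have "t *\<^sub>R p \<in> U" using tp[of t] t e by auto
      \<comment> \<open>The field at \<open>t *\<^sub>R p\<close> is that vector itself, so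
        linearity brings out a factor \<open>t\<close>, which cancels for \<open>t > 0\<close>;
        continuity takes care of the end point 0.\<close>
      then have "t * ?D p = 0"
        using inv linear_scale[OF lin, of t p] by (auto simp: scales_along_def)
      then have "?D p = 0" using t by simp
      then have "(\<lambda>h. ?D (h *\<^sub>R p)) = (*) 0" using linear_scale[OF lin] by (simp add: fun_eq_iff)
      then show "((\<lambda>t. f (t *\<^sub>R p)) has_real_derivative 0) (at t)"
        using deriv[of t] t by (simp add: has_field_derivative_def)
    qed simp
    then show ?thesis by simp
  qed
  have "frechet_derivative f (at p) = (\<lambda>v. 0)" if p: "p \<in> ball 0 e" for p
  proof (rule frechet_derivative_at[symmetric])
    show "(f has_derivative (\<lambda>v. 0)) (at p)"
      by (rule has_derivative_transform_within_open[OF has_derivative_const open_ball p])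
        (use const in auto)
  qed
  then show ?thesis by (simp add: scales_along_def)
qed

text \<open>A vector tangent to a graph is determined by its first two components. These force the
  parameter vector to be \<open>X p\<close>, and the other three components become the scaling
  equations.\<close>

lemma invariant_solution_scales_along:
  assumes "positive_metric U E F G" "invariant_solution U E F G Y"
    and "\<And>p e f g. Y (fst p, snd p, e, f, g) = (fst (X p), snd (X p), l * e, l * f, l * g)"
  shows "scales_along U X l E \<and> scales_along U X l F \<and> scales_along U X l G"
proof -
  have "frechet_derivative E (at p) (X p) = l * E p \<and> frechet_derivative F (at p) (X p) = l * F p \<and>
      frechet_derivative G (at p) (X p) = l * G p" if p: "p \<in> U" for p
  proof -
    let ?D = "\<lambda>v. (fst v, snd v, frechet_derivative E (at p) v, frechet_derivative F (at p) v,
      frechet_derivative G (at p) v)"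
    have "(E has_derivative frechet_derivative E (at p)) (at p)"
      "(F has_derivative frechet_derivative F (at p)) (at p)"
      "(G has_derivative frechet_derivative G (at p)) (at p)"
      using assms(1) smooth_on_has_derivative p by (auto simp: positive_metric_def)
    then have "(solution_graph E F G has_derivative ?D) (at p)"
      unfolding solution_graph_def[abs_def]
      by (intro has_derivative_Pair has_derivative_fst has_derivative_snd has_derivative_ident)
    then have "frechet_derivative (solution_graph E F G) (at p) = ?D"
      by (rule frechet_derivative_at[symmetric])
    moreover have "Y (solution_graph E F G p) \<in> range (frechet_derivative (solution_graph E F G) (at p))"
      using assms(2) p by (simp add: invariant_solution_def)
    ultimately obtain v where "Y (solution_graph E F G p) = ?D v" by auto
    then have "(fst (X p), snd (X p), l * E p, l * F p, l * G p) = ?D v"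
      by (simp add: solution_graph_def assms(3))
    moreover from this have "v = X p" by (simp add: prod_eq_iff)
    ultimately show ?thesis by simp
  qed
  then show ?thesis by (auto simp: scales_along_def)
qed

theorem corollary6:
  fixes U :: "(real \<times> real) set" and E F G :: "real \<times> real \<Rightarrow> real" and \<kappa> :: real
  assumes "open U"
    and "is_solution U E F G"
    and "invariant_solution U E F G (translation_field \<kappa>) \<or>
         \<kappa> \<noteq> -2 \<and> invariant_solution U E F G (dilation_field \<kappa>)"
  shows "locally_realizable_as_lie_spiral U E F G"
  unfolding locally_realizable_as_lie_spiral_def
proof
  fix p assume p: "p \<in> U"
  have metric: "positive_metric U E F G"
    using assms(2) by (simp add: is_solution_def positive_metric_def)
  from assms(3) show "\<exists>V f. open V \<and> p \<in> V \<and> V \<subseteq> U \<and>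
    isometric_immersion_on V E F G f \<and> lie_spiral_surface (f ` V)"
  proof
    assume "invariant_solution U E F G (translation_field \<kappa>)"
    then have "scales_along U (\<lambda>p. (1, \<kappa>)) 1 E \<and> scales_along U (\<lambda>p. (1, \<kappa>)) 1 F \<and>
        scales_along U (\<lambda>p. (1, \<kappa>)) 1 G"
      by (rule invariant_solution_scales_along[OF metric]) (simp add: translation_field_def)
    then show ?thesis
      using translation_invariant_metric_spiral_immersion[OF assms(1) metric, of \<kappa> 1 p] p by simp
  next
    assume *: "\<kappa> \<noteq> -2 \<and> invariant_solution U E F G (dilation_field \<kappa>)"
    then have "scales_along U (\<lambda>p. p) \<kappa> E \<and> scales_along U (\<lambda>p. p) \<kappa> F \<and> scales_along U (\<lambda>p. p) \<kappa> G"
      by (intro invariant_solution_scales_along[OF metric, where Y="dilation_field \<kappa>"])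
        (auto simp: dilation_field_def)
    then have inv: "scales_along U (\<lambda>p. p) \<kappa> E" "scales_along U (\<lambda>p. p) \<kappa> F" "scales_along U (\<lambda>p. p) \<kappa> G"
      by auto
    show ?thesis
    proof (cases "p = 0")
      case False
      then show ?thesis
        using dilation_invariant_metric_spiral_immersion[OF assms(1) metric, of 0 \<kappa> p] inv p * by simp
    next
      case True
      have sm: "smooth_on U E" "smooth_on U F" "smooth_on U G" and "E p > 0"
        using metric p by (auto simp: positive_metric_def)
      \<comment> \<open>The dilation field vanishes at the origin, so the scaling equation for
        \<open>E\<close> reads \<open>0 = \<kappa> * E p\<close> there, and positivity of
        \<open>E\<close> leaves only \<kappa> = 0.\<close>
      have "frechet_derivative E (at p) 0 = 0"
        using linear_0 has_derivative_linear smooth_on_has_derivative[OF sm(1) p] by blast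
      then have "\<kappa> = 0" using inv(1) p True \<open>E p > 0\<close> by (force simp: scales_along_def)
      obtain e where e: "e > 0" "ball 0 e \<subseteq> U"
        using assms(1) p True by (auto simp: open_contains_ball)
      let ?U = "ball (0 :: real \<times> real) e"
      have metric': "positive_metric ?U E F G"
        using metric e by (auto simp: positive_metric_def intro: smooth_on_subset)
      \<comment> \<open>With \<kappa> = 0 the coefficients are constant on the ball and scale with
        \<open>l = 0\<close> along a dilation about any centre; \<open>(1, 0)\<close> serves as a
        centre different from \<open>p\<close>.\<close>
      have "\<exists>V f. open V \<and> p \<in> V \<and> V \<subseteq> ?U \<and>
        isometric_immersion_on V E F G f \<and> lie_spiral_surface (f ` V)"
        using inv e True unfolding \<open>\<kappa> = 0\<close>
        by (intro dilation_invariant_metric_spiral_immersion[OF open_ball metric', of "(1, 0)" 0]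
            scales_along_zero_constant[OF sm(1)] scales_along_zero_constant[OF sm(2)]
            scales_along_zero_constant[OF sm(3)]) (auto simp: zero_prod_def)
      then show ?thesis using e by blast
    qed
  qed
qed

end
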